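(* Let $k\in\frac12\mathbb Z$, let $N$ be a positive integer (with $4\mid N$ if $k\in\frac12+\mathbb Z$), let $\chi$ be a character of $\Gamma_0(N)$, and let $f\in H_k^{\mathrm{Eis}}(N,\chi)$ and $g=f|w_N$ have the expansions (with $v=\operatorname{Im}\tau$, $q=e^{2\pi i\tau}$) $$f(\tau)=\sum_{n\ge 0}a^+(n)q^n+a^-(0)v^{1-k}+\sum_{n\ge1}a^-(n)\Gamma(1-k,4\pi nv)q^{-n},$$ $$g(\tau)=\sum_{n\ge 0}b^+(n)q^n+b^-(0)v^{1-k}+\sum_{n\ge1}b^-(n)\Gamma(1-k,4\pi nv)q^{-n}.$$ Let $\mu_f^{\pm},\mu_g^{\pm}\in\mathbb R^+$ be such that $a^\pm(n)=O(n^{\mu_f^\pm})$, $b^\pm(n)=O(n^{\mu_g^\pm})$, and put $\rho_0=\max\{2+2\mu_f^\pm-k,\,2+2\mu_g^\pm-k,\,k\}$ if $k\ge1$ and $\rho_0=\max\{3+2\mu_f^\pm-2k,\,3+2\mu_g^\pm-2k\}$ if $k<1$ (over both signs). Let $\rho>\rho_0-\frac12$ and put $$S(x)=\frac{1}{\Gamma(\rho+1)}\sum_{1\le n\le x}a^+(n)(x-n)^\rho+\frac{x^\rho}{2\pi i}\sum_{1\le n\le x}a^-(n)g_\rho(n,x).$$ Then, as $x\to\infty$, $$S(x)=Q_\rho(x)+O\big(x^{\frac\rho2+\max\{\frac14,\frac{2k-1}4\}}\big),$$ and moreover $$S(x)=\begin{cases}\dfrac{b^+(0)i^k(2\pi)^k}{N^{k/2}\Gamma(\rho+k+1)}x^{\rho+k}+O(x^{\rho+1}),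 & 1<k\le2,\\[2mm] \dfrac{2\pi i}{\sqrt N\,\Gamma(\rho+2)}\,(b^-(0)+b^+(0))\,x^{\rho+1}+O(x^\rho), & k=1,\\[2mm] \dfrac{2\pi N^{\frac k2-1}b^-(0)i^k}{\Gamma(\rho+2)}x^{\rho+1}+O(x^{\max\{\rho,\rho+k\}}), & k<1.\end{cases}$$ Here $$Q_\rho(x)=x^\rho\left(-\frac{a^+(0)}{\Gamma(\rho+1)}+\frac{2\pi xN^{\frac k2-1}b^-(0)i^k}{\Gamma(\rho+2)}-\frac{a^-(0)x^{k-1}(2\pi)^{k-1}}{\Gamma(\rho+k)}+\frac{b^+(0)i^kx^k(2\pi)^k}{N^{k/2}\Gamma(\rho+k+1)}\right),$$ $$g_\rho(n,x)=\frac{2\pi i}{\Gamma(k+\rho)}\Big(1+\frac nx\Big)^\rho\int_{\frac{2n}{x+n}}^1 t^{-k}(1-t)^{k+\rho-1}\,dt .$$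
   Context: All complex powers use the principal branch; $i^k=e^{\pi i k/2}$. $\Gamma(s,z)=\int_z^\infty t^{s-1}e^{-t}dt$ ($z>0$). Slash operator: for $\gamma=\begin{pmatrix}a&b\\c&d\end{pmatrix}\in\Gamma_0(N)$, $(f|_k\gamma)(\tau)=(c\tau+d)^{-k}f(\gamma\tau)$ if $k\in\mathbb Z$, and $(f|_k\gamma)(\tau)=\left(\frac cd\right)\varepsilon_d^{2k}(c\tau+d)^{-k}f(\gamma\tau)$ if $k\in\frac12+\mathbb Z$ (then $4\mid N$), where $\left(\frac cd\right)$ is the Kronecker symbol and $\varepsilon_d=1$ if $d\equiv1\pmod4$, $\varepsilon_d=i$ if $d\equiv3\pmod 4$. Laplacian: $\Delta_k=-4v^2\partial_\tau\partial_{\bar\tau}+2ikv\,\partial_{\bar\tau}$, $v=\operatorname{Im}\tau$. $H_k^{\mathrm{Eis}}(N,\chi)$ (harmonic Maass forms of polynomial growth) is the space of smooth $f:\mathbb H\to\mathbb C$ with $f|_k\gamma=\chi(\gamma)f$ for all $\gamma\in\Gamma_0(N)$, $\Delta_kf=0$, and polynomial growth at all cusps of $\Gamma_0(N)$. Fricke involution: $(f|w_N)(\tau):=N^{k/2}(N\tau)^{-k}f(-1/(N\tau))$. *)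

theory Defs
  imports "HOL-Analysis.Analysis" "HOL-Library.Landau_Symbols" "HOL-Number_Theory.Number_Theory"
begin

definition upper_half_plane :: "complex set" where
  "upper_half_plane = {\<tau>. Im \<tau> > 0}"

definition SL2Z :: "(int ^ 2 ^ 2) set" where
  "SL2Z = {\<gamma>. det \<gamma> = 1}"

definition Gamma0 :: "nat \<Rightarrow> (int ^ 2 ^ 2) set" where
  "Gamma0 N = {\<gamma> \<in> SL2Z. int N dvd \<gamma> $ 2 $ 1}"

text \<open>Characters are homomorphisms into the multiplicative group of nonzero complex numbers;
  they are not required to be unitary or to come from a Dirichlet character.\<close>

definition Gamma0_character :: "nat \<Rightarrow> (int ^ 2 ^ 2 \<Rightarrow> complex) \<Rightarrow> bool" where
  "Gamma0_character N \<psi> \<longleftrightarrow>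
     (\<forall>\<gamma>\<in>Gamma0 N. \<psi> \<gamma> \<noteq> 0) \<and>
     (\<forall>\<gamma>\<in>Gamma0 N. \<forall>\<delta>\<in>Gamma0 N. \<psi> (\<gamma> ** \<delta>) = \<psi> \<gamma> * \<psi> \<delta>)"

definition aut_denom :: "int ^ 2 ^ 2 \<Rightarrow> complex \<Rightarrow> complex" where
  "aut_denom \<gamma> \<tau> = of_int (\<gamma> $ 2 $ 1) * \<tau> + of_int (\<gamma> $ 2 $ 2)"

definition moebius_action :: "int ^ 2 ^ 2 \<Rightarrow> complex \<Rightarrow> complex" where
  "moebius_action \<gamma> \<tau> = (of_int (\<gamma> $ 1 $ 1) * \<tau> + of_int (\<gamma> $ 1 $ 2)) / aut_denom \<gamma> \<tau>"

definition kronecker_at_prime :: "int \<Rightarrow> nat \<Rightarrow> int" where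
  "kronecker_at_prime a p =
     (if p = 2 then (if even a then 0 else if a mod 8 \<in> {1, 7} then 1 else -1)
      else Legendre a (int p))"

definition kronecker_at_unit :: "int \<Rightarrow> int \<Rightarrow> int" where
  "kronecker_at_unit a n = (if n < 0 \<and> a < 0 then -1 else 1)"

definition kronecker_symbol :: "int \<Rightarrow> int \<Rightarrow> int" where
  "kronecker_symbol a n =
     (if n = 0 then (if \<bar>a\<bar> = 1 then 1 else 0)
      else kronecker_at_unit a n *
           (\<Prod>p\<in>prime_factors (nat \<bar>n\<bar>). kronecker_at_prime a p ^ multiplicity p (nat \<bar>n\<bar>)))"

text \<open>Only odd \<open>d\<close> matter, and \<open>d\<close> may be negative; \<open>mod\<close> takes values in \<open>{0,1,2,3}\<close>.\<close>

definition eps :: "int \<Rightarrow> complex" where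
  "eps d = (if d mod 4 = 1 then 1 else \<i>)"

definition slash :: "real \<Rightarrow> int ^ 2 ^ 2 \<Rightarrow> (complex \<Rightarrow> complex) \<Rightarrow> complex \<Rightarrow> complex" where
  "slash k \<gamma> f \<tau> =
     (if k \<in> \<int> then 1
      else of_int (kronecker_symbol (\<gamma> $ 2 $ 1) (\<gamma> $ 2 $ 2)) *
           eps (\<gamma> $ 2 $ 2) powr complex_of_real (2 * k)) *
     aut_denom \<gamma> \<tau> powr complex_of_real (- k) * f (moebius_action \<gamma> \<tau>)"

definition fricke :: "nat \<Rightarrow> real \<Rightarrow> (complex \<Rightarrow> complex) \<Rightarrow> complex \<Rightarrow> complex" where
  "fricke N k f \<tau> =
     complex_of_real (real N powr (k / 2)) * (of_nat N * \<tau>) powr complex_of_real (- k) *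
     f (- 1 / (of_nat N * \<tau>))"

text \<open>All derivatives are real: \<open>partial_u\<close> and \<open>partial_v\<close> are the partial derivatives
  in \<open>\<tau> = u + \<i> v\<close>.\<close>

definition partial_u :: "(complex \<Rightarrow> complex) \<Rightarrow> complex \<Rightarrow> complex" where
  "partial_u f \<tau> = frechet_derivative f (at \<tau>) 1"

definition partial_v :: "(complex \<Rightarrow> complex) \<Rightarrow> complex \<Rightarrow> complex" where
  "partial_v f \<tau> = frechet_derivative f (at \<tau>) \<i>"

primrec cont_diff_on :: "nat \<Rightarrow> (complex \<Rightarrow> complex) \<Rightarrow> complex set \<Rightarrow> bool" where
  "cont_diff_on 0 f S \<longleftrightarrow> continuous_on S f"
| "cont_diff_on (Suc n) f S \<longleftrightarrow>
     (\<forall>\<tau>\<in>S. f differentiable (at \<tau>)) \<and>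
     cont_diff_on n (partial_u f) S \<and> cont_diff_on n (partial_v f) S"

definition smooth_on_plane :: "(complex \<Rightarrow> complex) \<Rightarrow> complex set \<Rightarrow> bool" where
  "smooth_on_plane f S \<longleftrightarrow> (\<forall>n. cont_diff_on n f S)"

definition d_tau :: "(complex \<Rightarrow> complex) \<Rightarrow> complex \<Rightarrow> complex" where
  "d_tau f \<tau> = (partial_u f \<tau> - \<i> * partial_v f \<tau>) / 2"

definition d_tau_bar :: "(complex \<Rightarrow> complex) \<Rightarrow> complex \<Rightarrow> complex" where
  "d_tau_bar f \<tau> = (partial_u f \<tau> + \<i> * partial_v f \<tau>) / 2"

definition laplacian :: "real \<Rightarrow> (complex \<Rightarrow> complex) \<Rightarrow> complex \<Rightarrow> complex" where
  "laplacian k f \<tau> =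
     - 4 * complex_of_real ((Im \<tau>)\<^sup>2) * d_tau (d_tau_bar f) \<tau>
     + 2 * \<i> * complex_of_real (k * Im \<tau>) * d_tau_bar f \<tau>"

text \<open>The cusps are the points \<open>\<gamma>\<infinity>\<close> with \<open>\<gamma>\<close> in \<open>SL2Z\<close>. Growth there only involves the modulus
  of \<open>(c\<tau> + d)\<^sup>-\<^sup>k f(\<gamma>\<tau>)\<close>, so no multiplier for elements outside \<open>Gamma0 N\<close> is needed when \<open>k\<close> is
  half-integral.\<close>

definition polynomial_growth_at_cusps :: "real \<Rightarrow> (complex \<Rightarrow> complex) \<Rightarrow> bool" where
  "polynomial_growth_at_cusps k f \<longleftrightarrow>
     (\<forall>\<gamma>\<in>SL2Z. \<exists>C M v0. v0 > 0 \<and> (\<forall>\<tau>. Im \<tau> \<ge> v0 \<longrightarrow>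
        norm (aut_denom \<gamma> \<tau> powr complex_of_real (- k) * f (moebius_action \<gamma> \<tau>))
          \<le> C * Im \<tau> powr M))"

definition H_Eis :: "real \<Rightarrow> nat \<Rightarrow> (int ^ 2 ^ 2 \<Rightarrow> complex) \<Rightarrow> (complex \<Rightarrow> complex) set" where
  "H_Eis k N \<psi> =
     {f. smooth_on_plane f upper_half_plane \<and>
         (\<forall>\<gamma>\<in>Gamma0 N. \<forall>\<tau>\<in>upper_half_plane. slash k \<gamma> f \<tau> = \<psi> \<gamma> * f \<tau>) \<and>
         (\<forall>\<tau>\<in>upper_half_plane. laplacian k f \<tau> = 0) \<and>
         polynomial_growth_at_cusps k f}"

definition incomplete_Gamma :: "real \<Rightarrow> real \<Rightarrow> real" where
  "incomplete_Gamma s z = integral {z..} (\<lambda>t. t powr (s - 1) * exp (- t))"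

definition nome :: "complex \<Rightarrow> complex" where
  "nome \<tau> = exp (2 * complex_of_real pi * \<i> * \<tau>)"

definition has_Maass_expansion ::
    "real \<Rightarrow> (complex \<Rightarrow> complex) \<Rightarrow> (nat \<Rightarrow> complex) \<Rightarrow> (nat \<Rightarrow> complex) \<Rightarrow> bool" where
  "has_Maass_expansion k f ap am \<longleftrightarrow>
     (\<forall>\<tau>\<in>upper_half_plane.
        let hol = (\<lambda>n. ap n * nome \<tau> ^ n);
            nonhol = (\<lambda>n. am n * complex_of_real (incomplete_Gamma (1 - k) (4 * pi * real n * Im \<tau>))
                             * nome \<tau> powi (- int n))
        in summable hol \<and> summable (\<lambda>n. nonhol (Suc n)) \<and>
           f \<tau> = (\<Sum>n. hol n) + am 0 * complex_of_real (Im \<tau> powr (1 - k)) + (\<Sum>n. nonhol (Suc n)))"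

definition rho_zero :: "real \<Rightarrow> real \<Rightarrow> real \<Rightarrow> real \<Rightarrow> real \<Rightarrow> real" where
  "rho_zero k \<mu>fp \<mu>fm \<mu>gp \<mu>gm =
     (if k \<ge> 1 then Max {2 + 2 * \<mu>fp - k, 2 + 2 * \<mu>fm - k, 2 + 2 * \<mu>gp - k, 2 + 2 * \<mu>gm - k, k}
      else Max {3 + 2 * \<mu>fp - 2 * k, 3 + 2 * \<mu>fm - 2 * k, 3 + 2 * \<mu>gp - 2 * k, 3 + 2 * \<mu>gm - 2 * k})"

definition g_kernel :: "real \<Rightarrow> real \<Rightarrow> nat \<Rightarrow> real \<Rightarrow> complex" where
  "g_kernel k \<rho> n x =
     2 * complex_of_real pi * \<i> / complex_of_real (Gamma (k + \<rho>)) *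
     complex_of_real ((1 + real n / x) powr \<rho> *
       integral {2 * real n / (x + real n)..1} (\<lambda>t. t powr (- k) * (1 - t) powr (k + \<rho> - 1)))"

definition riesz_sum ::
    "real \<Rightarrow> real \<Rightarrow> (nat \<Rightarrow> complex) \<Rightarrow> (nat \<Rightarrow> complex) \<Rightarrow> real \<Rightarrow> complex" where
  "riesz_sum k \<rho> ap am x =
     1 / complex_of_real (Gamma (\<rho> + 1)) *
       (\<Sum>n | 1 \<le> n \<and> real n \<le> x. ap n * complex_of_real ((x - real n) powr \<rho>))
     + complex_of_real (x powr \<rho>) / (2 * complex_of_real pi * \<i>) *
       (\<Sum>n | 1 \<le> n \<and> real n \<le> x. am n * g_kernel k \<rho> n x)"

text \<open>The arguments \<open>a0p\<close>, \<open>a0m\<close>, \<open>b0p\<close>, \<open>b0m\<close> are the constant coefficients \<open>a\<^sup>+(0)\<close>, \<open>a\<^sup>-(0)\<close>,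
  \<open>b\<^sup>+(0)\<close>, \<open>b\<^sup>-(0)\<close>.\<close>

definition Q_main ::
    "real \<Rightarrow> nat \<Rightarrow> real \<Rightarrow> complex \<Rightarrow> complex \<Rightarrow> complex \<Rightarrow> complex \<Rightarrow> real \<Rightarrow> complex" where
  "Q_main k N \<rho> a0p a0m b0p b0m x =
     complex_of_real (x powr \<rho>) *
     (- a0p / complex_of_real (Gamma (\<rho> + 1))
      + complex_of_real (2 * pi * x * real N powr (k / 2 - 1)) * b0m * \<i> powr complex_of_real k
          / complex_of_real (Gamma (\<rho> + 2))
      - a0m * complex_of_real (x powr (k - 1) * (2 * pi) powr (k - 1))
          / complex_of_real (Gamma (\<rho> + k))
      + b0p * \<i> powr complex_of_real k * complex_of_real (x powr k * (2 * pi) powr k)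
          / complex_of_real (real N powr (k / 2) * Gamma (\<rho> + k + 1)))"

end

theory Submission
  imports Defs "HOL-Real_Asymp.Real_Asymp"
begin

text \<open>Put \<open>F(s) = f(is/2\<pi>)\<close> and \<open>G(s) = g(is/2\<pi>)\<close> for real \<open>s > 0\<close>. The Riesz sum, completed by the terms
  of \<open>a\<^sup>+(0)\<close> and \<open>a\<^sup>-(0)\<close>, is the inverse Laplace transform of \<open>s^(- \<rho> - 1) F(s)\<close>. On the imaginary axis
  the Fricke relation reads
  \<open>F(s) = i^k N^(- k/2) (2\<pi>)^k s^(- k) G(4\<pi>\<^sup>2/(N s))\<close>, and inverting the right-hand side term by term gives
  the two remaining main terms of \<open>Q\<^sub>\<rho>\<close> and a series of Bessel functions. The bound
  \<open>J\<^sub>\<nu>(y) = O(y^(- 1/2))\<close> makes this series converge absolutely in the range \<open>\<rho> > \<rho>\<^sub>0 - 1/2\<close> and be of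
  the size of the error term. Uniqueness of Laplace transforms needs only real \<open>s\<close>, so neither
  contour integrals nor a continuation in \<open>\<rho>\<close> is required.\<close>

subsection \<open>Laplace transforms of continuous functions of polynomial growth\<close>

text \<open>The subtracted 1/2 in the range of \<rho> is the gain from the decay of J. If J were
  merely bounded, the n-th terms of the inverted series would have size n^(\<mu>_g^+ - (\<rho> +
  k)/2) and n^(\<mu>_g^- - \<rho>/2 - k + 1/2), hence be summable for \<rho> > 2 + 2\<mu>_g^+ - k
  and \<rho> > 3 + 2\<mu>_g^- - 2k, which are entries of \<rho>_0. The decay saves n^(1/4) in every
  term, that is 1/2 in \<rho>, and leaves the powers \<rho>/2 + (2k - 1)/4 and \<rho>/2 + 1/4 of x.
  The two exponents differ because the Bessel index is \<rho> + k for the holomorphic terms of g but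
  \<rho> + 1 for the others: writing \<Gamma>(1 - k, .) as an integral of exponentials brings in a
  power of s that cancels k. On the side of f no convergence in n is at stake. A factor exp (- ns)
  delays the original by n, and the term of a^-(n) is a superposition of delays (2u - 1)n with u
  \<ge> 1, so at a given x only n \<le> x contributes.\<close>

text \<open>Continuity up to 0 lets uniqueness hold at every point, and polynomial growth makes the
  integral converge for each s > 0. The growth constants are bound inside, so an infinite
  superposition of pairs has to bring its own uniform bound.\<close>

definition laplace_pair ::
    "(real \<Rightarrow> 'a :: {banach, second_countable_topology}) \<Rightarrow> (real \<Rightarrow> 'a) \<Rightarrow> bool" where
  "laplace_pair h H \<longleftrightarrow>
     continuous_on {0..} h \<and>
     (\<exists>C m. \<forall>x\<ge>0. norm (h x) \<le> C * (1 + x) ^ m) \<and>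
     (\<forall>s>0. (LINT x:{0..}|lborel. exp (- (s * x)) *\<^sub>R h x) = H s)"

lemma has_bochner_integral_powr_exp:
  fixes p s :: real
  assumes "p > - 1" "s > 0"
  shows "has_bochner_integral lborel (\<lambda>x. indicator {0..} x * (x powr p * exp (- (s * x))))
           (Gamma (p + 1) * s powr (- p - 1))"
proof -
  have "has_bochner_integral lborel (\<lambda>t. indicator {0..} t * t powr p / exp t) (Gamma (p + 1))"
  proof (rule has_bochner_integral_nn_integral)
    show "(\<integral>\<^sup>+t. ennreal (indicator {0..} t * t powr p / exp t) \<partial>lborel) = ennreal (Gamma (p + 1))"
      using Gamma_conv_nn_integral_real[of "p + 1"] assms by simp
  qed (use assms in \<open>auto simp: Gamma_real_nonneg indicator_def\<close>)
  hence "has_bochner_integral lborel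
      (\<lambda>x. indicator {0..} (0 + s * x) * (0 + s * x) powr p / exp (0 + s * x))
      (Gamma (p + 1) /\<^sub>R \<bar>s\<bar>)"
    using lborel_has_bochner_integral_real_affine_iff[of s _ "Gamma (p + 1)" 0] assms by auto
  hence "has_bochner_integral lborel
      (\<lambda>x. s powr (- p) * (indicator {0..} (0 + s * x) * (0 + s * x) powr p / exp (0 + s * x)))
      (s powr (- p) * (Gamma (p + 1) /\<^sub>R \<bar>s\<bar>))"
    by (rule has_bochner_integral_mult_right)
  also have "(\<lambda>x. s powr (- p) * (indicator {0..} (0 + s * x) * (0 + s * x) powr p / exp (0 + s * x)))
      = (\<lambda>x. indicator {0..} x * (x powr p * exp (- (s * x))))"
    using assms
    by (auto simp: fun_eq_iff indicator_def powr_mult exp_minus field_simps powr_minus zero_le_mult_iff)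
  also have "s powr (- p) * (Gamma (p + 1) /\<^sub>R \<bar>s\<bar>) = Gamma (p + 1) * s powr (- p - 1)"
    using assms by (simp add: powr_diff field_simps)
  finally show ?thesis .
qed

lemma integrable_poly_exp:
  fixes s :: real
  assumes "s > 0"
  shows "integrable lborel (\<lambda>x. indicator {0..} x * (exp (- (s * x)) * (1 + x) ^ m))"
proof -
  have "integrable lborel (\<lambda>x. 2 ^ m * (indicator {0..} x * (x powr 0 * exp (- (s * x))) +
           indicator {0..} x * (x powr real m * exp (- (s * x)))))"
    using has_bochner_integral_powr_exp[of 0 s] has_bochner_integral_powr_exp[of "real m" s] assms
    by (intro integrable_mult_right integrable_add) (auto simp: has_bochner_integral_iff)
  thus ?thesis
  proof (rule Bochner_Integration.integrable_bound)
    show "AE x in lborel. norm (indicator {0..} x * (exp (- (s * x)) * (1 + x) ^ m)) \<le>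
       norm (2 ^ m * (indicator {0..} x * (x powr 0 * exp (- (s * x))) +
           indicator {0..} x * (x powr real m * exp (- (s * x)))))"
    \<comment> \<open>The point 0 is left out because \<open>0 powr 0 = 0\<close>: there the left
      side is 1 and the majorant is 0.\<close>
    proof (rule AE_mp[OF AE_lborel_singleton[of 0]], rule AE_I2, rule impI)
      fix x :: real assume "x \<noteq> 0"
      show "norm (indicator {0..} x * (exp (- (s * x)) * (1 + x) ^ m)) \<le>
       norm (2 ^ m * (indicator {0..} x * (x powr 0 * exp (- (s * x))) +
           indicator {0..} x * (x powr real m * exp (- (s * x)))))"
      proof (cases "x \<ge> 0")
        case True
        have "(1 + x) ^ m \<le> (2 * max 1 x) ^ m"
          using True by (intro power_mono) auto
        also have "\<dots> \<le> 2 ^ m * (1 + x ^ m)"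
          using True by (auto simp: power_mult_distrib max_def)
        finally have "exp (- (s * x)) * (1 + x) ^ m \<le> exp (- (s * x)) * (2 ^ m * (1 + x ^ m))"
          by (intro mult_left_mono) auto
        thus ?thesis
          using True \<open>x \<noteq> 0\<close>
          by (auto simp: powr_realpow abs_mult algebra_simps) 
      qed auto
    qed
  qed auto
qed

lemma laplace_pair_continuous: "laplace_pair h H \<Longrightarrow> continuous_on {0..} h"
  by (simp add: laplace_pair_def)

lemma laplace_pair_eq:
  "laplace_pair h H \<Longrightarrow> s > 0 \<Longrightarrow> (LINT x:{0..}|lborel. exp (- (s * x)) *\<^sub>R h x) = H s"
  by (simp add: laplace_pair_def)

lemma laplace_pair_integrable:
  assumes "laplace_pair h H" "s > 0"
  shows "set_integrable lborel {0..} (\<lambda>x. exp (- (s * x)) *\<^sub>R h x)"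
proof -
  obtain C m where Cm: "\<And>x. x \<ge> 0 \<Longrightarrow> norm (h x) \<le> C * (1 + x) ^ m"
    using assms by (auto simp: laplace_pair_def)
  have [measurable]: "(\<lambda>x. indicator {0..} x *\<^sub>R h x) \<in> borel_measurable borel"
    by (rule borel_measurable_continuous_on_indicator)
       (use assms in \<open>auto simp: laplace_pair_def\<close>)
  have "integrable lborel (\<lambda>x. C * (indicator {0..} x * (exp (- (s * x)) * (1 + x) ^ m)))"
    using integrable_poly_exp[OF assms(2)] by auto
  hence "integrable lborel (\<lambda>x. exp (- (s * x)) *\<^sub>R (indicator {0..} x *\<^sub>R h x))"
  proof (rule Bochner_Integration.integrable_bound)
    show "AE x in lborel. norm (exp (- (s * x)) *\<^sub>R (indicator {0..} x *\<^sub>R h x)) \<le>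
            norm (C * (indicator {0..} x * (exp (- (s * x)) * (1 + x) ^ m)))"
      using Cm by (intro AE_I2) (auto simp: indicator_def abs_mult algebra_simps
        intro!: mult_left_mono order.trans[OF _ mult_right_mono[OF abs_ge_self]])
  qed measurable
  thus ?thesis
    by (simp add: set_integrable_def mult.commute)
qed

section \<open>Linear maps, sums, powers, scaling and delay of transform pairs\<close>

lemma laplace_pair_bounded_linear:
  assumes "laplace_pair h H" "bounded_linear T"
  shows "laplace_pair (\<lambda>x. T (h x)) (\<lambda>s. T (H s))"
  unfolding laplace_pair_def
proof (intro conjI allI impI)
  interpret bounded_linear T by fact
  show "continuous_on {0..} (\<lambda>x. T (h x))"
    by (intro continuous_on laplace_pair_continuous[OF assms(1)])
  obtain C m where Cm: "\<And>x. x \<ge> 0 \<Longrightarrow> norm (h x) \<le> C * (1 + x) ^ m"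
    using assms by (auto simp: laplace_pair_def)
  obtain K where K: "K \<ge> 0" "\<And>x. norm (T x) \<le> norm x * K"
    using nonneg_bounded by blast
  have "norm (T (h x)) \<le> (C * K) * (1 + x) ^ m" if "x \<ge> 0" for x
    using K(2)[of "h x"] mult_right_mono[OF Cm[OF that] K(1)] by (simp add: algebra_simps)
  thus "\<exists>C m. \<forall>x\<ge>0. norm (T (h x)) \<le> C * (1 + x) ^ m" by blast
  fix s :: real assume "s > 0"
  have "T (LINT x:{0..}|lborel. exp (- (s * x)) *\<^sub>R h x) = (LINT x:{0..}|lborel. exp (- (s * x)) *\<^sub>R T (h x))"
    unfolding set_lebesgue_integral_def
    using laplace_pair_integrable[OF assms(1) \<open>s > 0\<close>] 
    by (subst integral_bounded_linear[OF assms(2), symmetric]) (auto simp: set_integrable_def scaleR)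
  thus "(LINT x:{0..}|lborel. exp (- (s * x)) *\<^sub>R T (h x)) = T (H s)"
    using assms(1) \<open>s > 0\<close> by (simp add: laplace_pair_def)
qed

lemma laplace_pair_add:
  assumes "laplace_pair h H" "laplace_pair h' H'"
  shows "laplace_pair (\<lambda>x. h x + h' x) (\<lambda>s. H s + H' s)"
  unfolding laplace_pair_def
proof (intro conjI allI impI)
  show "continuous_on {0..} (\<lambda>x. h x + h' x)"
    using assms by (intro continuous_on_add laplace_pair_continuous)
  obtain C m where 1: "\<And>x. x \<ge> 0 \<Longrightarrow> norm (h x) \<le> C * (1 + x) ^ m"
    using assms by (auto simp: laplace_pair_def)
  obtain C' m' where 2: "\<And>x. x \<ge> 0 \<Longrightarrow> norm (h' x) \<le> C' * (1 + x) ^ m'"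
    using assms by (auto simp: laplace_pair_def)
  have "norm (h x + h' x) \<le> (\<bar>C\<bar> + \<bar>C'\<bar>) * (1 + x) ^ (max m m')" if "x \<ge> 0" for x
  proof -
    have "norm (h x) \<le> \<bar>C\<bar> * (1 + x) ^ max m m'" "norm (h' x) \<le> \<bar>C'\<bar> * (1 + x) ^ max m m'"
      by (rule order.trans[OF 1[OF that]], intro mult_mono power_increasing)
         (use that in \<open>auto intro!: order.trans[OF 2[OF that]] mult_mono power_increasing\<close>)
    thus ?thesis
      by (intro norm_triangle_le) (simp add: algebra_simps)
  qed
  thus "\<exists>C m. \<forall>x\<ge>0. norm (h x + h' x) \<le> C * (1 + x) ^ m" by blast
  fix s :: real assume "s > 0"
  thus "(LINT x:{0..}|lborel. exp (- (s * x)) *\<^sub>R (h x + h' x)) = H s + H' s"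
    using assms laplace_pair_integrable[OF assms(1) \<open>s > 0\<close>] laplace_pair_integrable[OF assms(2) \<open>s > 0\<close>]
    by (simp add: scaleR_add_right set_integral_add laplace_pair_def)
qed

lemma laplace_pair_mult:
  fixes c :: "'a :: {real_normed_algebra, banach, second_countable_topology}"
  assumes "laplace_pair h H"
  shows "laplace_pair (\<lambda>x. c * h x) (\<lambda>s. c * H s)"
  using laplace_pair_bounded_linear[OF assms bounded_linear_mult_right] .

lemma laplace_pair_of_real:
  assumes "laplace_pair h H"
  shows "laplace_pair (\<lambda>x. complex_of_real (h x)) (\<lambda>s. complex_of_real (H s))"
  using laplace_pair_bounded_linear[OF assms bounded_linear_of_real] .

lemma laplace_pair_cong:
  assumes "laplace_pair h H" "\<And>x. x \<ge> 0 \<Longrightarrow> h x = h' x" "\<And>s. s > 0 \<Longrightarrow> H s = H' s"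
  shows "laplace_pair h' H'"
proof -
  have "(LINT x:{0..}|lborel. exp (- (s * x)) *\<^sub>R h x) = (LINT x:{0..}|lborel. exp (- (s * x)) *\<^sub>R h' x)" for s
    using assms(2) by (intro set_lebesgue_integral_cong) auto
  moreover have "continuous_on {0..} h \<longleftrightarrow> continuous_on {0..} h'"
    using assms(2) by (intro continuous_on_cong) auto
  ultimately show ?thesis
    using assms unfolding laplace_pair_def by (auto simp: )
qed

text \<open>Positivity of p gives continuity at 0, which a pair demands; for p = 0 the convention
  \<open>0 powr 0 = 0\<close> would produce a jump.\<close>

lemma laplace_pair_powr:
  fixes p :: real
  assumes "p > 0"
  shows "laplace_pair (\<lambda>x. x powr p / Gamma (p + 1)) (\<lambda>s. s powr (- p - 1))"
  unfolding laplace_pair_def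
proof (intro conjI allI impI)
  have G: "Gamma (p + 1) > 0" using assms by (intro Gamma_real_pos) auto
  show "continuous_on {0..} (\<lambda>x. x powr p / Gamma (p + 1))"
    using assms less_imp_neq[OF G]
    by (intro continuous_on_divide[OF continuous_on_powr'] continuous_intros) auto
  have "norm (x powr p / Gamma (p + 1)) \<le> (1 / Gamma (p + 1)) * (1 + x) ^ nat \<lceil>p\<rceil>" if "x \<ge> 0" for x
  proof -
    have "x powr p \<le> (1 + x) powr p"
      using that assms by (intro powr_mono2) auto
    also have "\<dots> \<le> (1 + x) powr real (nat \<lceil>p\<rceil>)"
      using that by (intro powr_mono) (auto, linarith)
    also have "\<dots> = (1 + x) ^ nat \<lceil>p\<rceil>" using that by (simp add: powr_realpow)
    finally show ?thesis using G by (simp add: field_simps)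
  qed
  thus "\<exists>C m. \<forall>x\<ge>0. norm (x powr p / Gamma (p + 1)) \<le> C * (1 + x) ^ m" by blast
  fix s :: real assume "s > 0"
  from has_bochner_integral_powr_exp[of p s] this assms
  have "(LINT x|lborel. indicator {0..} x * (x powr p * exp (- (s * x))) / Gamma (p + 1)) =
        (Gamma (p + 1) * s powr (- p - 1)) / Gamma (p + 1)"
    by (simp add: has_bochner_integral_iff)
  thus "(LINT x:{0..}|lborel. exp (- (s * x)) *\<^sub>R (x powr p / Gamma (p + 1))) = s powr (- p - 1)"
    using G by (simp add: set_lebesgue_integral_def mult_ac)
qed

lemma laplace_pair_scale:
  assumes "laplace_pair h H" "c > 0"
  shows "laplace_pair (\<lambda>x. h (c * x)) (\<lambda>s. H (s / c) /\<^sub>R c)"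
  unfolding laplace_pair_def
proof (intro conjI allI impI)
  show "continuous_on {0..} (\<lambda>x. h (c * x))"
    by (rule continuous_on_compose2[OF laplace_pair_continuous[OF assms(1)]])
       (use assms in \<open>auto intro!: continuous_intros\<close>)
  obtain C m where 1: "\<And>x. x \<ge> 0 \<Longrightarrow> norm (h x) \<le> C * (1 + x) ^ m"
    using assms by (auto simp: laplace_pair_def)
  have "norm (h (c * x)) \<le> (\<bar>C\<bar> * (1 + c) ^ m) * (1 + x) ^ m" if "x \<ge> 0" for x
  proof -
    have "norm (h (c * x)) \<le> C * (1 + c * x) ^ m" using that assms by (intro 1) auto
    also have "\<dots> \<le> \<bar>C\<bar> * ((1 + c) * (1 + x)) ^ m"
      using that assms by (intro mult_mono power_mono) (auto simp: algebra_simps)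
    finally show ?thesis by (simp add: power_mult_distrib mult_ac)
  qed
  thus "\<exists>C m. \<forall>x\<ge>0. norm (h (c * x)) \<le> C * (1 + x) ^ m" by blast
  fix s :: real assume "s > 0"
  have "H (s / c) = (LINT x:{0..}|lborel. exp (- (s / c * x)) *\<^sub>R h x)"
    using laplace_pair_eq[OF assms(1), of "s / c"] assms(2) \<open>s > 0\<close> by simp
  also have "\<dots> = c *\<^sub>R (LINT x:{0..}|lborel. exp (- (s * x)) *\<^sub>R h (c * x))"
    unfolding set_lebesgue_integral_def
    by (subst lborel_integral_real_affine[where c = c and t = 0])
       (use assms in \<open>auto intro!: Bochner_Integration.integral_cong simp: indicator_def zero_le_mult_iff\<close>)
  finally show "(LINT x:{0..}|lborel. exp (- (s * x)) *\<^sub>R h (c * x)) = H (s / c) /\<^sub>R c"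
    using assms by simp
qed

text \<open>The maximum encodes the cut-off of a delayed function: left of c the value is
  \<open>h 0 = 0\<close>, so the delay stays continuous and the stretch from 0 to c adds nothing to
  the transform.\<close>

lemma laplace_pair_shift:
  assumes "laplace_pair h H" "c \<ge> 0" "h 0 = 0"
  shows "laplace_pair (\<lambda>x. h (max 0 (x - c))) (\<lambda>s. exp (- (c * s)) *\<^sub>R H s)"
  unfolding laplace_pair_def
proof (intro conjI allI impI)
  show "continuous_on {0..} (\<lambda>x. h (max 0 (x - c)))"
    by (rule continuous_on_compose2[OF laplace_pair_continuous[OF assms(1)]])
       (use assms in \<open>auto intro!: continuous_intros\<close>)
  obtain C m where 1: "\<And>x. x \<ge> 0 \<Longrightarrow> norm (h x) \<le> C * (1 + x) ^ m"
    using assms by (auto simp: laplace_pair_def)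
  have "norm (h (max 0 (x - c))) \<le> \<bar>C\<bar> * (1 + x) ^ m" if "x \<ge> 0" for x
  proof -
    have "norm (h (max 0 (x - c))) \<le> C * (1 + max 0 (x - c)) ^ m" using that assms by (intro 1) auto
    also have "\<dots> \<le> \<bar>C\<bar> * (1 + x) ^ m"
      using that assms by (intro mult_mono power_mono) auto
    finally show ?thesis .
  qed
  thus "\<exists>C m. \<forall>x\<ge>0. norm (h (max 0 (x - c))) \<le> C * (1 + x) ^ m" by blast
  fix s :: real assume "s > 0"
  have "(LINT x:{0..}|lborel. exp (- (s * x)) *\<^sub>R h (max 0 (x - c))) =
        (LINT x|lborel. exp (- (c * s)) *\<^sub>R (indicator {0..} x *\<^sub>R (exp (- (s * x)) *\<^sub>R h x)))"
    unfolding set_lebesgue_integral_def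
    by (subst lborel_integral_real_affine[where c = 1 and t = c])
       (use assms in \<open>auto intro!: Bochner_Integration.integral_cong
          simp: indicator_def max_def algebra_simps simp flip: exp_add\<close>)
  also have "\<dots> = exp (- (c * s)) *\<^sub>R H s"
    using laplace_pair_eq[OF assms(1) \<open>s > 0\<close>]
    by (subst integral_scaleR_right) (simp add: set_lebesgue_integral_def)
  finally show "(LINT x:{0..}|lborel. exp (- (s * x)) *\<^sub>R h (max 0 (x - c))) = exp (- (c * s)) *\<^sub>R H s" .
qed

section \<open>Superposition of transform pairs\<close>

text \<open>Fubini with the product of \<open>c\<close> and the weighted polynomial as majorant. The
  exponent m is common to all i; this uniformity also gives continuity and polynomial growth of the
  superposition. It is applied to the counting measure and to Lebesgue measure in the variable u of
  the incomplete Gamma function.\<close>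

lemma laplace_pair_integral:
  fixes h :: "'i \<Rightarrow> real \<Rightarrow> 'a :: {banach, second_countable_topology}"
  assumes M: "sigma_finite_measure M"
    and meas: "(\<lambda>(i, x). indicator {0..} x *\<^sub>R h i x) \<in> borel_measurable (M \<Otimes>\<^sub>M lborel)"
    and pair: "\<And>i. i \<in> space M \<Longrightarrow> laplace_pair (h i) (H i)"
    and c: "integrable M c"
    and bound: "\<And>i x. i \<in> space M \<Longrightarrow> x \<ge> 0 \<Longrightarrow> norm (h i x) \<le> c i * (1 + x) ^ m"
  shows "laplace_pair (\<lambda>x. \<integral>i. h i x \<partial>M) (\<lambda>s. \<integral>i. H i s \<partial>M)"
  unfolding laplace_pair_def
proof (intro conjI allI impI)
  interpret pair_sigma_finite M lborel
    by (intro pair_sigma_finite.intro M sigma_finite_lborel)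
  have [measurable]: "c \<in> borel_measurable M" using c by simp
  have c_nonneg: "c i \<ge> 0" if "i \<in> space M" for i
    using order.trans[OF norm_ge_zero bound[OF that, of 0]] by simp
  have meas1: "(\<lambda>i. h i x) \<in> borel_measurable M" if "x \<ge> 0" for x
  proof -
    have "(\<lambda>i. indicator {0..} x *\<^sub>R h i x) \<in> borel_measurable M"
      using measurable_compose[OF measurable_Pair2'[of x lborel M] meas] by simp
    thus ?thesis using that by simp
  qed
  show "continuous_on {0..} (\<lambda>x. \<integral>i. h i x \<partial>M)"
  proof (rule continuous_on_sequentiallyI)
    fix u :: "nat \<Rightarrow> real" and a assume u: "\<forall>n. u n \<in> {0..}" "a \<in> {0..}" "u \<longlonglongrightarrow> a"
    \<comment> \<open>A convergent sequence is bounded, so one majorant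
      \<open>c i * (1 + X) ^ m\<close> serves all its members in dominated convergence.\<close>
    obtain X where X: "\<And>n. norm (u n) \<le> X"
      using Bseq_def convergent_imp_Bseq[of u] u(3) unfolding convergent_def by blast
    show "(\<lambda>n. \<integral>i. h i (u n) \<partial>M) \<longlonglongrightarrow> (\<integral>i. h i a \<partial>M)"
    proof (rule integral_dominated_convergence[where w = "\<lambda>i. c i * (1 + X) ^ m"])
      show "(\<lambda>i. h i a) \<in> borel_measurable M" "(\<lambda>i. h i (u n)) \<in> borel_measurable M" for n
        using u by (auto intro!: meas1)
      show "integrable M (\<lambda>i. c i * (1 + X) ^ m)"
        using c by simp
      show "AE i in M. (\<lambda>n. h i (u n)) \<longlonglongrightarrow> h i a"
      proof (rule AE_I2)
        fix i assume "i \<in> space M"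
        from laplace_pair_continuous[OF pair[OF this]] u
        show "(\<lambda>n. h i (u n)) \<longlonglongrightarrow> h i a"
          unfolding continuous_on_sequentially o_def by blast
      qed
      show "AE i in M. norm (h i (u n)) \<le> c i * (1 + X) ^ m" for n
      proof (rule AE_I2)
        fix i assume i: "i \<in> space M"
        have "norm (h i (u n)) \<le> c i * (1 + u n) ^ m" using bound[OF i] u by simp
        also have "\<dots> \<le> c i * (1 + X) ^ m"
          using X[of n] u(1) c_nonneg[OF i] by (intro mult_left_mono power_mono) (auto simp: abs_le_iff)
        finally show "norm (h i (u n)) \<le> c i * (1 + X) ^ m" .
      qed
    qed
  qed
  have "norm (\<integral>i. h i x \<partial>M) \<le> (\<integral>i. c i \<partial>M) * (1 + x) ^ m" if "x \<ge> 0" for x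
  proof -
    have dom: "integrable M (\<lambda>i. c i * (1 + x) ^ m)"
      using c by simp
    hence "integrable M (\<lambda>i. h i x)"
      by (rule Bochner_Integration.integrable_bound[OF _ meas1[OF that] AE_I2])
         (use bound that c_nonneg in auto)
    hence "norm (\<integral>i. h i x \<partial>M) \<le> (\<integral>i. c i * (1 + x) ^ m \<partial>M)"
      by (intro order.trans[OF Bochner_Integration.integral_norm_bound
            Bochner_Integration.integral_mono[OF integrable_norm dom]]) (use bound that in auto)
    thus ?thesis by simp
  qed
  thus "\<exists>C m. \<forall>x\<ge>0. norm (\<integral>i. h i x \<partial>M) \<le> C * (1 + x) ^ m" by blast
  fix s :: real assume s: "s > 0"
  define d where "d = (\<lambda>x::real. indicator {0..} x * (exp (- (s * x)) * (1 + x) ^ m))"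
  have d: "integrable lborel d" unfolding d_def by (rule integrable_poly_exp[OF s])
  have [measurable]: "d \<in> borel_measurable borel" using d by (auto dest: borel_measurable_integrable)
  have "integrable (M \<Otimes>\<^sub>M lborel) (\<lambda>p. c (fst p) * d (snd p))"
    by (rule Fubini_integrable) (use c d in \<open>auto simp: norm_mult abs_mult\<close>)
  hence int: "integrable (M \<Otimes>\<^sub>M lborel) (\<lambda>(i, x). exp (- (s * x)) *\<^sub>R (indicator {0..} x *\<^sub>R h i x))"
  proof (rule Bochner_Integration.integrable_bound)
    show "(\<lambda>(i, x). exp (- (s * x)) *\<^sub>R (indicator {0..} x *\<^sub>R h i x)) \<in> borel_measurable (M \<Otimes>\<^sub>M lborel)"
      unfolding case_prod_beta
      using meas[unfolded case_prod_beta] by measurable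
    show "AE p in M \<Otimes>\<^sub>M lborel. norm (case p of (i, x) \<Rightarrow> exp (- (s * x)) *\<^sub>R (indicator {0..} x *\<^sub>R h i x))
             \<le> norm (c (fst p) * d (snd p))"
      using bound c_nonneg
      by (intro AE_I2) (auto simp: space_pair_measure d_def indicator_def abs_mult mult_ac
           intro!: mult_left_mono)
  qed
  have "(LINT x:{0..}|lborel. exp (- (s * x)) *\<^sub>R (\<integral>i. h i x \<partial>M)) =
        (\<integral>x. (\<integral>i. exp (- (s * x)) *\<^sub>R (indicator {0..} x *\<^sub>R h i x) \<partial>M) \<partial>lborel)"
    by (simp add: set_lebesgue_integral_def mult.commute)
  also have "\<dots> = (\<integral>i. (\<integral>x. exp (- (s * x)) *\<^sub>R (indicator {0..} x *\<^sub>R h i x) \<partial>lborel) \<partial>M)"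
    by (rule Fubini_integral[OF int])
  also have "\<dots> = (\<integral>i. H i s \<partial>M)"
    using laplace_pair_eq[OF pair s]
    by (intro Bochner_Integration.integral_cong) (simp_all add: set_lebesgue_integral_def mult.commute)
  finally show "(LINT x:{0..}|lborel. exp (- (s * x)) *\<^sub>R (\<integral>i. h i x \<partial>M)) = (\<integral>i. H i s \<partial>M)" .
qed

text \<open>A series is an integral for the counting measure once it converges absolutely, and this
  has to be checked twice: for the originals at x and for the transforms at s.\<close>

lemma laplace_pair_suminf:
  fixes h :: "nat \<Rightarrow> real \<Rightarrow> 'a :: {banach, second_countable_topology}"
  assumes pair: "\<And>n. laplace_pair (h n) (H n)"
    and c: "summable c"
    and bound: "\<And>n x. x \<ge> 0 \<Longrightarrow> norm (h n x) \<le> c n * (1 + x) ^ m"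
  shows "laplace_pair (\<lambda>x. \<Sum>n. h n x) (\<lambda>s. \<Sum>n. H n s)"
proof -
  have c_nonneg: "c n \<ge> 0" for n
    using order.trans[OF norm_ge_zero bound[of 0 n]] by simp
  have c': "integrable (count_space UNIV) c"
    using c c_nonneg by (simp add: integrable_count_space_nat_iff)
  have "laplace_pair (\<lambda>x. \<integral>n. h n x \<partial>count_space UNIV) (\<lambda>s. \<integral>n. H n s \<partial>count_space UNIV)"
  proof (rule laplace_pair_integral)
    show "sigma_finite_measure (count_space (UNIV :: nat set))"
      by (rule sigma_finite_measure_count_space)
    show "(\<lambda>(n, x). indicator {0..} x *\<^sub>R h n x) \<in> borel_measurable (count_space UNIV \<Otimes>\<^sub>M lborel)"
      by (intro measurable_pair_measure_countable1)
         (use laplace_pair_continuous[OF pair] in \<open>auto intro!: borel_measurable_continuous_on_indicator\<close>)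
  qed (use pair c' bound in auto)
  thus ?thesis
  proof (rule laplace_pair_cong)
    fix x :: real assume "x \<ge> 0"
    have "summable (\<lambda>n. norm (h n x))"
      by (rule summable_comparison_test'[OF summable_mult2[OF c, of "(1 + x) ^ m"], of 0])
         (use bound \<open>x \<ge> 0\<close> in auto)
    thus "(\<integral>n. h n x \<partial>count_space UNIV) = (\<Sum>n. h n x)"
      by (intro integral_count_space_nat) (simp add: integrable_count_space_nat_iff)
  next
    fix s :: real assume s: "s > 0"
    define D where "D = (\<integral>x. indicator {0..} x * (exp (- (s * x)) * (1 + x) ^ m) \<partial>lborel)"
    have "norm (H n s) \<le> c n * D" for n
    proof -
      have "norm (LINT x:{0..}|lborel. exp (- (s * x)) *\<^sub>R h n x) \<le>
            (\<integral>x. c n * (indicator {0..} x * (exp (- (s * x)) * (1 + x) ^ m)) \<partial>lborel)"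
        unfolding set_lebesgue_integral_def
        using laplace_pair_integrable[OF pair s] integrable_poly_exp[OF s] bound
        by (intro Bochner_Integration.integral_norm_bound_integral)
           (auto simp: set_integrable_def indicator_def mult_ac intro!: mult_left_mono)
      thus ?thesis
        using pair[of n] s by (simp add: laplace_pair_def D_def)
    qed
    hence "summable (\<lambda>n. norm (H n s))"
      by (intro summable_comparison_test'[OF summable_mult2[OF c, of D], of 0]) auto
    thus "(\<integral>n. H n s \<partial>count_space UNIV) = (\<Sum>n. H n s)"
      by (intro integral_count_space_nat) (simp add: integrable_count_space_nat_iff)
  qed
qed

text \<open>Lerch's theorem: after \<open>u = exp (- x)\<close> the transform at the positive integers gives the moments
  of the continuous function \<open>K\<close> on \<open>[0,1]\<close>, so Weierstrass approximation of \<open>K\<close> itself yields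
  \<open>\<integral> w\<^sup>2 = 0\<close>.\<close>
lemma laplace_pair_zero_real:
  fixes h :: "real \<Rightarrow> real"
  assumes h: "laplace_pair h (\<lambda>_. 0)" and "x0 \<ge> 0"
  shows "h x0 = 0"
proof -
  obtain C m where Cm: "\<And>x. x \<ge> 0 \<Longrightarrow> norm (h x) \<le> C * (1 + x) ^ m"
    using h by (auto simp: laplace_pair_def)
  define w where "w = (\<lambda>x. exp (- x) * h x)"
  have w_int: "set_integrable lborel {0..} w"
    using laplace_pair_integrable[OF h, of 1] by (simp add: w_def)
  have w_cont: "continuous_on {0..} w"
    unfolding w_def by (intro continuous_intros laplace_pair_continuous[OF h])
  \<comment> \<open>The value 0 at u = 0 is the limit of \<open>w\<close> at infinity, so
    \<open>K\<close> is continuous on the closed unit interval, as Weierstrass approximation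
    requires.\<close>
  define K where "K = (\<lambda>u. if u \<le> 0 then 0 else w (- ln u))"
  have lim: "((\<lambda>x::real. C * (1 + x) ^ m * exp (- x)) \<longlongrightarrow> 0) at_top"
    by real_asymp
  have w_lim: "(w \<longlongrightarrow> 0) at_top"
  proof (rule Lim_null_comparison[OF _ lim])
    show "\<forall>\<^sub>F x in at_top. norm (w x) \<le> C * (1 + x) ^ m * exp (- x)"
      using eventually_ge_at_top[of 0]
      by eventually_elim (use Cm in \<open>auto simp: w_def abs_mult mult_ac intro!: mult_left_mono\<close>)
  qed
  have K_cont: "continuous_on {0..1} K"
  proof (rule continuous_on_eq_continuous_within[THEN iffD2], rule ballI)
    fix u :: real assume u: "u \<in> {0..1}"
    show "continuous (at u within {0..1}) K"
    proof (cases "u = 0")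
      case True
      have "filterlim (\<lambda>u::real. - ln u) at_top (at_right 0)"
        by real_asymp
      from filterlim_compose[OF w_lim this] have "((\<lambda>u. w (- ln u)) \<longlongrightarrow> 0) (at_right 0)" .
      hence "(K \<longlongrightarrow> 0) (at_right 0)"
        by (rule Lim_transform_eventually) (auto simp: eventually_at_filter K_def)
      hence "(K \<longlongrightarrow> 0) (at 0 within {0..1})"
        by (rule tendsto_mono[rotated]) (auto simp: at_within_def intro!: le_infI2)
      thus ?thesis using True by (simp add: continuous_within K_def)
    next
      case False
      have "continuous_on {0<..1} (\<lambda>u. w (- ln u))"
        by (rule continuous_on_compose2[OF w_cont]) (auto intro!: continuous_intros)
      hence "continuous_on {0<..1} K"
        by (subst (asm) continuous_on_cong[OF refl, of _ _ K]) (auto simp: K_def)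
      hence "continuous (at u within {0<..1}) K"
        using u False by (auto simp: continuous_on_eq_continuous_within)
      moreover have "at u within {0<..1} = at u within {0..1}"
        using u False by (intro at_within_nhd[of _ "{0<..}"]) auto
      ultimately show ?thesis by (simp add: continuous_within)
    qed
  qed
  have K_exp: "K (exp (- x)) = w x" for x
    by (simp add: K_def)
  have sq_int: "set_integrable lborel {0..} (\<lambda>x. w x * w x)"
  proof -
    have "compact (K ` {0..1})" using K_cont by (rule compact_continuous_image) auto
    from compact_imp_bounded[OF this] obtain B where B: "\<forall>y\<in>K ` {0..1}. norm y \<le> B"
      unfolding bounded_iff by (rule exE)
    have [measurable]: "(\<lambda>x. indicator {0..} x *\<^sub>R (w x * w x)) \<in> borel_measurable borel"
      by (rule borel_measurable_continuous_on_indicator[OF _ continuous_on_mult[OF w_cont w_cont]]) simp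
    show ?thesis
      unfolding set_integrable_def
    proof (rule Bochner_Integration.integrable_bound)
      show "integrable lborel (\<lambda>x. B * (indicator {0..} x *\<^sub>R w x))"
        using w_int by (auto simp: set_integrable_def)
      have "\<bar>w x * w x\<bar> \<le> \<bar>B * w x\<bar>" if "x \<ge> 0" for x
        using bspec[OF B, of "K (exp (- x))"] that unfolding K_exp[symmetric] abs_mult
        by (intro mult_right_mono) auto
      thus "AE x in lborel. norm (indicator {0..} x *\<^sub>R (w x * w x)) \<le> norm (B * (indicator {0..} x *\<^sub>R w x))"
        by (auto simp: indicator_def)
    qed measurable
  qed
  define I where "I = (LINT x:{0..}|lborel. w x * w x)"
  define W where "W = (LINT x:{0..}|lborel. \<bar>w x\<bar>)"
  have W: "W \<ge> 0" unfolding W_def set_lebesgue_integral_def by (intro Bochner_Integration.integral_nonneg) auto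
  have "I \<le> e * W" if "e > 0" for e
  proof -
    obtain g where g: "real_polynomial_function g" "\<And>u. u \<in> {0..1} \<Longrightarrow> \<bar>K u - g u\<bar> < e"
      using Stone_Weierstrass_real_polynomial_function[OF compact_Icc K_cont \<open>e > 0\<close>] by metis
    obtain a n where an: "g = (\<lambda>u. \<Sum>i\<le>n. a i * u ^ i)"
      using g(1) real_polynomial_function_iff_sum by auto
    have term_int: "set_integrable lborel {0..} (\<lambda>x. a i * (exp (- (real (Suc i) * x)) * h x))" for i
      using laplace_pair_integrable[OF h, of "real (Suc i)"] by simp
    \<comment> \<open>\<open>w\<close> already contains one factor exp (- x), so the monomial of
      degree i gives the transform at i + 1, a positive point even for the constant
      monomial.\<close>
    have wg: "w x * g (exp (- x)) = (\<Sum>i\<le>n. a i * (exp (- (real (Suc i) * x)) * h x))" for x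
      by (auto simp: w_def an sum_distrib_left exp_of_nat_mult[symmetric] algebra_simps
               simp flip: exp_add intro!: sum.cong)
    have wg_int: "set_integrable lborel {0..} (\<lambda>x. w x * g (exp (- x)))"
      unfolding wg set_integrable_def scaleR_sum_right
      by (rule Bochner_Integration.integrable_sum) (use term_int in \<open>auto simp: set_integrable_def\<close>)
    have "(LINT x:{0..}|lborel. w x * g (exp (- x))) =
          (\<Sum>i\<le>n. LINT x:{0..}|lborel. a i * (exp (- (real (Suc i) * x)) * h x))"
      unfolding wg set_lebesgue_integral_def scaleR_sum_right
      by (rule Bochner_Integration.integral_sum) (use term_int in \<open>auto simp: set_integrable_def\<close>)
    also have "\<dots> = 0"
      using laplace_pair_eq[OF h, of "real (Suc i)" for i] by (intro sum.neutral) simp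
    finally have "I = (LINT x:{0..}|lborel. w x * w x) - (LINT x:{0..}|lborel. w x * g (exp (- x)))"
      by (simp add: I_def)
    also have "\<dots> = (LINT x:{0..}|lborel. w x * w x - w x * g (exp (- x)))"
      by (rule set_integral_diff(2)[symmetric]) fact+
    also have "\<dots> \<le> (LINT x:{0..}|lborel. e * \<bar>w x\<bar>)"
    proof (rule set_integral_mono)
      show "set_integrable lborel {0..} (\<lambda>x. w x * w x - w x * g (exp (- x)))"
        by (rule set_integral_diff(1)) fact+
      show "set_integrable lborel {0..} (\<lambda>x. e * \<bar>w x\<bar>)"
        using set_integrable_abs[OF w_int] by simp
      fix x :: real assume "x \<in> {0..}"
      have "w x * w x - w x * g (exp (- x)) \<le> \<bar>w x\<bar> * \<bar>K (exp (- x)) - g (exp (- x))\<bar>"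
        unfolding K_exp by (subst abs_mult[symmetric], rule order.trans[OF _ abs_ge_self]) (simp add: algebra_simps)
      also have "\<dots> \<le> \<bar>w x\<bar> * e"
        using g(2)[of "exp (- x)"] \<open>x \<in> {0..}\<close> by (intro mult_left_mono) auto
      finally show "w x * w x - w x * g (exp (- x)) \<le> e * \<bar>w x\<bar>" by (simp add: mult_ac)
    qed
    finally show ?thesis by (simp add: W_def)
  qed
  \<comment> \<open>\<open>W\<close> may be 0, hence the division by \<open>W + 1\<close>.\<close>
  hence "I \<le> e" if "e > 0" for e
    using that W order.trans[OF \<open>\<And>e. e > 0 \<Longrightarrow> I \<le> e * W\<close>[of "e / (W + 1)"], of e]
    by (auto simp: field_simps)
  hence I0: "I \<le> 0" by (rule field_le_epsilon[of I 0, simplified])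
  \<comment> \<open>Going beyond \<open>x0\<close> keeps the interval nondegenerate also for
    \<open>x0 = 0\<close>; on it a nonnegative continuous function with integral 0 vanishes.\<close>
  define b where "b = x0 + 1"
  have cont_b: "continuous_on {0..b} (\<lambda>x. w x * w x)"
    by (intro continuous_intros continuous_on_subset[OF w_cont]) auto
  have int_b: "set_integrable lborel {0..b} (\<lambda>x. w x * w x)"
    by (rule borel_integrable_atLeastAtMost'[OF cont_b])
  have "integral {0..b} (\<lambda>x. w x * w x) = (LINT x:{0..b}|lborel. w x * w x)"
    by (rule set_borel_integral_eq_integral(2)[OF int_b, symmetric])
  also have "\<dots> \<le> I"
    using int_b sq_int unfolding I_def set_lebesgue_integral_def set_integrable_def
    by (intro Bochner_Integration.integral_mono) (auto simp: indicator_def)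
  finally have "integral {0..b} (\<lambda>x. w x * w x) = 0"
    using I0 Henstock_Kurzweil_Integration.integral_nonneg[OF integrable_continuous_interval[OF cont_b]] by fastforce
  hence "w x0 * w x0 = 0"
    using integral_eq_0_iff[OF cont_b] assms(2) by (auto simp: b_def)
  thus ?thesis by (simp add: w_def)
qed

lemma laplace_pair_unique:
  fixes h h' :: "real \<Rightarrow> complex"
  assumes "laplace_pair h H" "laplace_pair h' H" "x \<ge> 0"
  shows "h x = h' x"
proof -
  have "laplace_pair (\<lambda>x. h x - h' x) (\<lambda>_. 0)"
    using laplace_pair_add[OF assms(1) laplace_pair_mult[OF assms(2), of "-1"]] by simp
  from laplace_pair_zero_real[OF laplace_pair_bounded_linear[OF this bounded_linear_Re, simplified] assms(3)]
    laplace_pair_zero_real[OF laplace_pair_bounded_linear[OF this bounded_linear_Im, simplified] assms(3)]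
  show ?thesis by (simp add: complex_eq_iff)
qed

subsection \<open>Bessel functions\<close>

definition bessel_coeff :: "real \<Rightarrow> nat \<Rightarrow> real" where
  "bessel_coeff \<nu> m = (-1) ^ m * rGamma (\<nu> + real m + 1) / fact m"

text \<open>For x > 0 this is x^(- \<nu>/2) J_\<nu>(2 sqrt x), the Bessel-Clifford function at - x.
  Without the fractional power it is entire, so derivatives and recurrences can be read off the
  coefficients.\<close>

definition bessel_entire :: "real \<Rightarrow> real \<Rightarrow> real" where
  "bessel_entire \<nu> x = (\<Sum>m. bessel_coeff \<nu> m * x ^ m)"

text \<open>In classical notation this is \<open>x\<close> to the power \<open>\<nu>/2\<close> times \<open>J\<^sub>\<nu>(2\<surd>x)\<close>.\<close>
definition bessel_riesz :: "real \<Rightarrow> real \<Rightarrow> real" where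
  "bessel_riesz \<nu> x = x powr \<nu> * bessel_entire \<nu> x"

text \<open>Each unit step in the argument divides the reciprocal Gamma function by \<nu> + m + 1
  \<ge> 1. Hence the exponential series dominates the Bessel series.\<close>

lemma rGamma_shift_bounds:
  fixes \<nu> :: real
  assumes "\<nu> \<ge> 0"
  shows "rGamma (\<nu> + real m + 1) > 0" "rGamma (\<nu> + real m + 1) \<le> rGamma (\<nu> + 1)"
proof -
  show pos: "rGamma (\<nu> + real m + 1) > 0" for m
    using assms Gamma_real_pos[of "\<nu> + real m + 1"] by (simp add: rGamma_inverse_Gamma)
  show "rGamma (\<nu> + real m + 1) \<le> rGamma (\<nu> + 1)"
  proof (induction m)
    case (Suc m)
    have "1 * rGamma (\<nu> + real (Suc m) + 1) \<le> (\<nu> + real m + 1) * rGamma (\<nu> + real m + 1 + 1)"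
      using assms pos[of "Suc m"] by (intro mult_mono) (auto simp: add_ac)
    also have "\<dots> = rGamma (\<nu> + real m + 1)" by (rule rGamma_plus1)
    finally show ?case using Suc by simp
  qed simp
qed

lemma summable_bessel_coeff:
  assumes "\<nu> \<ge> 0"
  shows "summable (\<lambda>m. norm (bessel_coeff \<nu> m * x ^ m))"
proof (rule summable_comparison_test'[of _ 0])
  show "summable (\<lambda>m. rGamma (\<nu> + 1) * (\<bar>x\<bar> ^ m /\<^sub>R fact m))"
    by (intro summable_mult summable_exp_generic)
  show "norm (norm (bessel_coeff \<nu> m * x ^ m)) \<le> rGamma (\<nu> + 1) * (\<bar>x\<bar> ^ m /\<^sub>R fact m)" for m
    using rGamma_shift_bounds[OF assms, of m]
    by (auto simp: bessel_coeff_def abs_mult power_abs divide_simps intro!: mult_right_mono)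
qed

lemma bessel_entire_sums:
  "\<nu> \<ge> 0 \<Longrightarrow> (\<lambda>m. bessel_coeff \<nu> m * x ^ m) sums bessel_entire \<nu> x"
  unfolding bessel_entire_def
  by (intro summable_sums summable_norm_cancel[OF summable_bessel_coeff])

lemma bessel_entire_has_derivative:
  assumes "\<nu> \<ge> 0"
  shows "(bessel_entire \<nu> has_real_derivative - bessel_entire (\<nu> + 1) x) (at x)"
proof -
  have "(bessel_entire \<nu> has_real_derivative (\<Sum>m. diffs (bessel_coeff \<nu>) m * x ^ m)) (at x)"
    unfolding bessel_entire_def[abs_def]
    by (rule termdiffs_strong_converges_everywhere)
       (use summable_norm_cancel[OF summable_bessel_coeff[OF assms]] in auto)
  also have "(\<lambda>m. diffs (bessel_coeff \<nu>) m * x ^ m) = (\<lambda>m. - (bessel_coeff (\<nu> + 1) m * x ^ m))"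
  proof
    fix m
    have "\<nu> + real (Suc m) + 1 = \<nu> + 1 + real m + 1" by simp
    thus "diffs (bessel_coeff \<nu>) m * x ^ m = - (bessel_coeff (\<nu> + 1) m * x ^ m)"
      unfolding diffs_def bessel_coeff_def by (simp only: fact_Suc) (simp add: field_simps del: of_nat_Suc)
  qed
  also have "(\<Sum>m. - (bessel_coeff (\<nu> + 1) m * x ^ m)) = - bessel_entire (\<nu> + 1) x"
    using sums_minus[OF bessel_entire_sums[of "\<nu> + 1" x]] assms by (auto simp: sums_iff)
  finally show ?thesis .
qed

text \<open>The three-term recurrence of J. As differentiation sends index \<nu> to \<nu> + 1 with a
  minus sign, it is also Bessel's equation x \<phi>'' + (\<nu> + 1) \<phi>' + \<phi> = 0 for \<phi>
  = \<open>bessel_entire \<nu>\<close>.\<close>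

lemma bessel_entire_rec:
  assumes "\<nu> \<ge> 0"
  shows "x * bessel_entire (\<nu> + 2) x = (\<nu> + 1) * bessel_entire (\<nu> + 1) x - bessel_entire \<nu> x"
proof -
  have eq: "(\<nu> + 1) * (bessel_coeff (\<nu> + 1) (Suc m) * x ^ Suc m) - bessel_coeff \<nu> (Suc m) * x ^ Suc m
        = x * (bessel_coeff (\<nu> + 2) m * x ^ m)" for m
  proof -
    have "(\<nu> + real m + 2) * rGamma (\<nu> + real m + 3) = rGamma (\<nu> + real m + 2)"
      using rGamma_plus1[of "\<nu> + real m + 2"] by (simp add: add_ac)
    moreover have "(\<nu> + 1) * rGamma (\<nu> + real m + 3) - rGamma (\<nu> + real m + 2) = - real (Suc m) * rGamma (\<nu> + real m + 3)"
      using calculation by (simp add: algebra_simps)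
    hence "(-1) ^ Suc m * x ^ Suc m / fact (Suc m) * ((\<nu> + 1) * rGamma (\<nu> + real m + 3) - rGamma (\<nu> + real m + 2)) =
      (-1) ^ Suc m * x ^ Suc m / fact (Suc m) * (- real (Suc m) * rGamma (\<nu> + real m + 3))"
      by (rule arg_cong)
    moreover have "(-1) ^ Suc m * x ^ Suc m / fact (Suc m) * (- real (Suc m) * rGamma (\<nu> + real m + 3))
       = x * (bessel_coeff (\<nu> + 2) m * x ^ m)"
      by (simp add: bessel_coeff_def divide_simps add_ac del: of_nat_Suc)
    ultimately show ?thesis
      unfolding bessel_coeff_def by (simp add: algebra_simps diff_divide_distrib add_divide_distrib)
  qed
  \<comment> \<open>The factor x shifts the other side up by one degree, so the constant term here
    must vanish; this is \<Gamma>(\<nu> + 2) = (\<nu> + 1) \<Gamma>(\<nu> + 1).\<close>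
  have eq0: "(\<nu> + 1) * (bessel_coeff (\<nu> + 1) 0 * x ^ 0) - bessel_coeff \<nu> 0 * x ^ 0 = 0"
    using rGamma_plus1[of "\<nu> + 1"] by (simp add: bessel_coeff_def)
  have "(\<lambda>m. (\<nu> + 1) * (bessel_coeff (\<nu> + 1) m * x ^ m) - bessel_coeff \<nu> m * x ^ m) sums
     ((\<nu> + 1) * bessel_entire (\<nu> + 1) x - bessel_entire \<nu> x)"
    using assms by (intro sums_diff sums_mult bessel_entire_sums) auto
  hence "(\<lambda>m. (\<nu> + 1) * (bessel_coeff (\<nu> + 1) (Suc m) * x ^ Suc m) - bessel_coeff \<nu> (Suc m) * x ^ Suc m) sums
     ((\<nu> + 1) * bessel_entire (\<nu> + 1) x - bessel_entire \<nu> x)"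
    by (subst sums_Suc_iff) (simp only: eq0 add_0_right)
  hence "(\<lambda>m. x * (bessel_coeff (\<nu> + 2) m * x ^ m)) sums
     ((\<nu> + 1) * bessel_entire (\<nu> + 1) x - bessel_entire \<nu> x)"
    by (simp only: eq)
  moreover have "(\<lambda>m. x * (bessel_coeff (\<nu> + 2) m * x ^ m)) sums (x * bessel_entire (\<nu> + 2) x)"
    using assms by (intro sums_mult bessel_entire_sums) auto
  ultimately show ?thesis by (rule sums_unique2[symmetric])
qed

text \<open>With \<open>w = x\<^sup>a \<phi>\<close>, \<open>a = \<nu>/2 + 1/4\<close>, the Bessel equation becomes
  \<open>x w'' + w'/2 + (1 - \<kappa>/x) w = 0\<close>, so the energy \<open>E = w\<^sup>2 + x w'\<^sup>2\<close> satisfies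
  \<open>E' = 2 \<kappa> w w'/x \<le> \<bar>\<kappa>\<bar> x\<^sup>-\<^sup>3\<^sup>/\<^sup>2 E\<close>, and \<open>E exp (2\<bar>\<kappa>\<bar>/\<surd>x)\<close> decreases.\<close>
lemma bessel_entire_bound_large:
  assumes "\<nu> \<ge> 0"
  shows "\<exists>C. \<forall>x\<ge>1. \<bar>x powr (\<nu> / 2 + 1 / 4) * bessel_entire \<nu> x\<bar> \<le> C"
proof -
  \<comment> \<open>The exponent offsets the expected decay x^(- \<nu>/2 - 1/4) of
    \<open>bessel_entire \<nu>\<close>, so that \<open>w\<close> should stay bounded.\<close>
  define a where "a = \<nu> / 2 + 1 / 4"
  define \<kappa> where "\<kappa> = \<nu>\<^sup>2 / 4 - 1 / 16"
  define w where "w = (\<lambda>x. x powr a * bessel_entire \<nu> x)"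
  define w1 where "w1 = (\<lambda>x. x powr a * (a * bessel_entire \<nu> x / x - bessel_entire (\<nu> + 1) x))"
  define V where "V = (\<lambda>x. ((w x)\<^sup>2 + x * (w1 x)\<^sup>2) * exp (2 * \<bar>\<kappa>\<bar> / sqrt x))"
  have D0: "(bessel_entire \<nu> has_real_derivative - bessel_entire (\<nu> + 1) x) (at x)" for x
    using bessel_entire_has_derivative assms by simp
  have D1: "(bessel_entire (\<nu> + 1) has_real_derivative - bessel_entire (\<nu> + 2) x) (at x)" for x
    using bessel_entire_has_derivative[of "\<nu> + 1" x] assms by (simp add: add.assoc)
  have w_deriv: "(w has_real_derivative w1 x) (at x)" if "x > 0" for x
    unfolding w_def w1_def
    by (rule derivative_eq_intros D0 refl | use that in \<open>simp add: powr_diff field_simps\<close>)+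
  have w1_deriv: "(w1 has_real_derivative (- (w1 x / 2) - w x * (1 - \<kappa> / x)) / x) (at x)" if "x > 0" for x
  proof -
    define y where "y = x powr a"
    define p where "p = bessel_entire \<nu> x"
    define q where "q = bessel_entire (\<nu> + 1) x"
    define r where "r = bessel_entire (\<nu> + 2) x"
    \<comment> \<open>The coefficient 2a + 1/2 is \<nu> + 1.\<close>
    have r: "r = ((2 * a + 1 / 2) * q - p) / x"
      using bessel_entire_rec[OF assms, of x] that by (simp add: p_def q_def r_def a_def field_simps)
    have \<kappa>: "\<kappa> = a * a - a / 2"
      by (simp add: \<kappa>_def a_def field_simps power2_eq_square)
    have w: "w x = y * p" "w1 x = y * (a * p / x - q)"
      by (simp_all add: w_def w1_def y_def p_def q_def)
    have "(w1 has_real_derivative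
            (a * x powr (a - 1)) * (a * p / x - q) + y * ((a * (- q) * x - a * p) / (x * x) + r)) (at x)"
      unfolding w1_def y_def p_def q_def r_def
      by (rule derivative_eq_intros D0 D1 refl | use that in \<open>simp\<close>)+
    also have "a * x powr (a - 1) = a * y / x" using that by (simp add: powr_diff y_def)
    also have "(a * y / x) * (a * p / x - q) + y * ((a * (- q) * x - a * p) / (x * x) + r) =
       (- (w1 x / 2) - w x * (1 - \<kappa> / x)) / x"
      unfolding w r \<kappa> using that by (simp add: field_simps)
    finally show ?thesis .
  qed
  have V_deriv: "(V has_real_derivative
      ((2 * \<kappa> * w x * w1 x / x) - \<bar>\<kappa>\<bar> / (x * sqrt x) * ((w x)\<^sup>2 + x * (w1 x)\<^sup>2)) * exp (2 * \<bar>\<kappa>\<bar> / sqrt x)) (at x)"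
    if "x > 0" for x
  proof -
    define t where "t = sqrt x"
    have t: "t > 0" "x = t * t" using that by (auto simp: t_def)
    have e: "((\<lambda>x. exp (2 * \<bar>\<kappa>\<bar> / sqrt x)) has_real_derivative
       exp (2 * \<bar>\<kappa>\<bar> / sqrt x) * (- (\<bar>\<kappa>\<bar> / (x * sqrt x)))) (at x)"
      by (rule derivative_eq_intros refl | use that t in \<open>simp add: field_simps flip: t_def\<close>)+
    define W2 where "W2 = (- (w1 x / 2) - w x * (1 - \<kappa> / x)) / x"
    have "((\<lambda>x. (w x)\<^sup>2 + x * (w1 x)\<^sup>2) has_real_derivative
      (2 * w x * w1 x + ((w1 x)\<^sup>2 + x * (2 * w1 x * W2)))) (at x)"
      unfolding W2_def
      by (rule derivative_eq_intros w_deriv w1_deriv refl that | simp add: algebra_simps)+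
    from DERIV_mult[OF this e] have "(V has_real_derivative
      (2 * w x * w1 x + ((w1 x)\<^sup>2 + x * (2 * w1 x * W2))) * exp (2 * \<bar>\<kappa>\<bar> / sqrt x) +
      (exp (2 * \<bar>\<kappa>\<bar> / sqrt x) * (- (\<bar>\<kappa>\<bar> / (x * sqrt x)))) * ((w x)\<^sup>2 + x * (w1 x)\<^sup>2)) (at x)"
      by (simp add: V_def[abs_def])
    also have "(2 * w x * w1 x + ((w1 x)\<^sup>2 + x * (2 * w1 x * W2))) = 2 * \<kappa> * w x * w1 x / x"
      unfolding W2_def using that by (simp add: field_simps power2_eq_square)
    finally show ?thesis
      by (rule DERIV_cong) (simp add: left_diff_distrib right_diff_distrib mult_ac)
  qed
  have V_le: "V x \<le> V 1" if "x \<ge> 1" for x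
  proof (rule DERIV_nonpos_imp_nonincreasing[OF that])
    fix z :: real assume z: "1 \<le> z" "z \<le> x"
    \<comment> \<open>With this t the energy is the sum of the squares of \<open>w z\<close> and
      \<open>t * w1 z\<close>, and twice a product is at most the sum of the squares.\<close>
    define t where "t = sqrt z"
    have t: "t > 0" "z = t * t" using z by (auto simp: t_def)
    have "2 * \<kappa> * w z * w1 z / z = \<kappa> * (2 * w z * (t * w1 z)) / (t * t * t)"
      using t by (simp add: field_simps)
    also have "\<dots> \<le> \<bar>\<kappa>\<bar> * ((w z)\<^sup>2 + (t * w1 z)\<^sup>2) / (t * t * t)"
    proof (rule divide_right_mono)
      have "\<bar>2 * w z * (t * w1 z)\<bar> \<le> (w z)\<^sup>2 + (t * w1 z)\<^sup>2"
        using sum_squares_bound[of "\<bar>w z\<bar>" "\<bar>t * w1 z\<bar>"] by (simp add: abs_mult power_mult_distrib)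
      hence "\<bar>\<kappa>\<bar> * \<bar>2 * w z * (t * w1 z)\<bar> \<le> \<bar>\<kappa>\<bar> * ((w z)\<^sup>2 + (t * w1 z)\<^sup>2)"
        by (intro mult_left_mono) auto
      thus "\<kappa> * (2 * w z * (t * w1 z)) \<le> \<bar>\<kappa>\<bar> * ((w z)\<^sup>2 + (t * w1 z)\<^sup>2)"
        unfolding abs_mult[of \<kappa>, symmetric] by (rule order.trans[OF abs_ge_self])
    qed (use t in auto)
    also have "\<dots> = \<bar>\<kappa>\<bar> / (z * sqrt z) * ((w z)\<^sup>2 + z * (w1 z)\<^sup>2)"
      using t by (simp add: power_mult_distrib power2_eq_square flip: t_def)
    finally have "((2 * \<kappa> * w z * w1 z / z) - \<bar>\<kappa>\<bar> / (z * sqrt z) * ((w z)\<^sup>2 + z * (w1 z)\<^sup>2)) * exp (2 * \<bar>\<kappa>\<bar> / sqrt z) \<le> 0"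
      by (intro mult_nonpos_nonneg) auto
    thus "\<exists>y. (V has_real_derivative y) (at z) \<and> y \<le> 0"
      using V_deriv[of z] z by auto
  qed
  have "\<bar>w x\<bar> \<le> sqrt (V 1)" if "x \<ge> 1" for x
  proof (rule real_le_rsqrt)
    have "(w x)\<^sup>2 * 1 \<le> V x"
      unfolding V_def using that by (intro mult_mono) auto
    thus "\<bar>w x\<bar>\<^sup>2 \<le> V 1" using V_le[OF that] by simp
  qed
  thus ?thesis by (auto simp: w_def a_def)
qed

text \<open>For x \<ge> 1 this is the decay of J. For x \<le> 1 the entire factor is bounded and
  \<nu> \<ge> \<nu>/2 - 1/4, so the same power dominates. A single pure power on the whole half-line
  is what later makes the bound scale exactly with n and u.\<close>

lemma bessel_riesz_bound:
  assumes "\<nu> \<ge> 0"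
  obtains C where "C \<ge> 0" "\<And>x. x \<ge> 0 \<Longrightarrow> \<bar>bessel_riesz \<nu> x\<bar> \<le> C * x powr (\<nu> / 2 - 1 / 4)"
proof -
  obtain C where C: "\<And>x. x \<ge> 1 \<Longrightarrow> \<bar>x powr (\<nu> / 2 + 1 / 4) * bessel_entire \<nu> x\<bar> \<le> C"
    using bessel_entire_bound_large[OF assms] by blast
  define C' where "C' = (\<Sum>m. norm (bessel_coeff \<nu> m * 1 ^ m))"
  have small: "\<bar>bessel_entire \<nu> x\<bar> \<le> C'" if "0 \<le> x" "x \<le> 1" for x
  proof -
    have "\<bar>bessel_entire \<nu> x\<bar> \<le> (\<Sum>m. norm (bessel_coeff \<nu> m * x ^ m))"
      unfolding bessel_entire_def real_norm_def[symmetric]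
      by (rule summable_norm[OF summable_bessel_coeff[OF assms]])
    also have "\<dots> \<le> C'"
      unfolding C'_def using that
      by (intro suminf_le summable_bessel_coeff assms)
         (auto simp: abs_mult power_le_one intro!: mult_left_le)
    finally show ?thesis .
  qed
  have "\<bar>bessel_riesz \<nu> x\<bar> \<le> max C C' * x powr (\<nu> / 2 - 1 / 4)" if "x \<ge> 0" for x
  proof (cases "x \<ge> 1")
    case True
    have "\<bar>bessel_riesz \<nu> x\<bar> = x powr (\<nu> / 2 - 1 / 4) * \<bar>x powr (\<nu> / 2 + 1 / 4) * bessel_entire \<nu> x\<bar>"
      by (simp add: bessel_riesz_def abs_mult powr_add[symmetric] mult.assoc[symmetric])
    also have "\<dots> \<le> x powr (\<nu> / 2 - 1 / 4) * max C C'"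
      using C[OF True] by (intro mult_left_mono) auto
    finally show ?thesis by (simp add: mult_ac)
  next
    case False
    have "x powr \<nu> \<le> x powr (\<nu> / 2 - 1 / 4)"
      using False that assms by (cases "x = 0") (auto intro!: powr_mono')
    moreover have "\<bar>bessel_entire \<nu> x\<bar> \<le> max C C'" using small[of x] that False by auto
    ultimately show ?thesis
      unfolding bessel_riesz_def abs_mult
      by (subst mult.commute, intro mult_mono) auto
  qed
  moreover have "max C C' \<ge> 0" using small[of 0] by linarith
  ultimately show ?thesis using that by blast
qed

text \<open>Termwise integration: the Gamma factor of the integral of x^(m + \<nu>) cancels the one
  in the coefficient and leaves the exponential series of - 1/s. With \<nu> > 1/2 the exponent
  \<nu>/2 - 1/4 in the growth bound is positive.\<close>

lemma laplace_pair_bessel_riesz: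
  assumes "\<nu> > 1 / 2"
  shows "laplace_pair (bessel_riesz \<nu>) (\<lambda>s. exp (- (1 / s)) * s powr (- \<nu> - 1))"
  unfolding laplace_pair_def
proof (intro conjI allI impI)
  have \<nu>: "\<nu> \<ge> 0" using assms by simp
  have "continuous_on {0..} (bessel_entire \<nu>)"
    by (meson DERIV_isCont bessel_entire_has_derivative continuous_at_imp_continuous_on \<nu>)
  thus "continuous_on {0..} (bessel_riesz \<nu>)"
    unfolding bessel_riesz_def[abs_def] using assms
    by (intro continuous_on_mult continuous_on_powr' continuous_intros) auto
  obtain C where C: "C \<ge> 0" "\<And>x. x \<ge> 0 \<Longrightarrow> \<bar>bessel_riesz \<nu> x\<bar> \<le> C * x powr (\<nu> / 2 - 1 / 4)"
    using bessel_riesz_bound[OF \<nu>] by blast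
  have "norm (bessel_riesz \<nu> x) \<le> C * (1 + x) ^ nat \<lceil>\<nu>\<rceil>" if "x \<ge> 0" for x
  proof -
    have "x powr (\<nu> / 2 - 1 / 4) \<le> (1 + x) powr (\<nu> / 2 - 1 / 4)"
      using that assms by (intro powr_mono2) auto
    also have "\<dots> \<le> (1 + x) powr real (nat \<lceil>\<nu>\<rceil>)"
      using that assms by (intro powr_mono) (auto, linarith)
    also have "\<dots> = (1 + x) ^ nat \<lceil>\<nu>\<rceil>" using that by (simp add: powr_realpow)
    finally show ?thesis using C(2)[OF that] mult_left_mono[OF _ C(1)] by fastforce
  qed
  thus "\<exists>C m. \<forall>x\<ge>0. norm (bessel_riesz \<nu> x) \<le> C * (1 + x) ^ m" by blast
  fix s :: real assume s: "s > 0"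
  define f where "f = (\<lambda>m x. bessel_coeff \<nu> m * (indicator {0..} x * (x powr (real m + \<nu>) * exp (- (s * x)))))"
  have hbi: "has_bochner_integral lborel (\<lambda>x. indicator {0..} x * (x powr (real m + \<nu>) * exp (- (s * x))))
           (Gamma (real m + \<nu> + 1) * s powr (- (real m + \<nu>) - 1))" for m
    by (rule has_bochner_integral_powr_exp) (use s assms in auto)
  have G: "Gamma (real m + \<nu> + 1) * rGamma (\<nu> + real m + 1) = 1" for m
    using less_imp_neq[OF Gamma_real_pos[of "real m + \<nu> + 1"]] assms
    by (auto simp: rGamma_inverse_Gamma add_ac)
  have pw: "s powr (- (real m + \<nu>) - 1) = (1 / s) ^ m * s powr (- \<nu> - 1)" for m
  proof -
    have "s powr (- (real m + \<nu>) - 1) = s powr (- real m) * s powr (- \<nu> - 1)"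
      by (simp add: powr_add[symmetric] algebra_simps)
    thus ?thesis using s by (simp add: powr_minus powr_realpow power_inverse divide_inverse)
  qed
  have int: "(\<integral>x. f m x \<partial>lborel) = s powr (- \<nu> - 1) * ((- (1 / s)) ^ m /\<^sub>R fact m)" for m
  proof -
    have "(\<integral>x. f m x \<partial>lborel) = bessel_coeff \<nu> m * (Gamma (real m + \<nu> + 1) * s powr (- (real m + \<nu>) - 1))"
      unfolding f_def using hbi[of m] by (simp add: has_bochner_integral_iff)
    also have "\<dots> = (-1) ^ m * (Gamma (real m + \<nu> + 1) * rGamma (\<nu> + real m + 1)) * s powr (- (real m + \<nu>) - 1) / fact m"
      by (simp add: bessel_coeff_def)
    also have "\<dots> = s powr (- \<nu> - 1) * ((- (1 / s)) ^ m /\<^sub>R fact m)"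
      unfolding G pw using power_minus[of "1 / s" m] by (simp add: field_simps)
    finally show ?thesis .
  qed
  \<comment> \<open>Only the sign (-1)^m is lost, so the norms still sum to an exponential, now of
    1/s, and series and integral may be interchanged.\<close>
  have int_norm: "(\<integral>x. norm (f m x) \<partial>lborel) = s powr (- \<nu> - 1) * ((1 / s) ^ m /\<^sub>R fact m)" for m
  proof -
    have "\<bar>bessel_coeff \<nu> m\<bar> = (-1) ^ m * bessel_coeff \<nu> m"
      using rGamma_shift_bounds(1)[OF \<nu>, of m] by (cases "even m") (auto simp: bessel_coeff_def abs_mult)
    hence "(\<lambda>x. norm (f m x)) = (\<lambda>x. (-1) ^ m * f m x)"
      by (simp add: f_def fun_eq_iff abs_mult mult.assoc)
    hence "(\<integral>x. norm (f m x) \<partial>lborel) = (-1) ^ m * (\<integral>x. f m x \<partial>lborel)" by simp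
    thus ?thesis unfolding int by (cases "even m") simp_all
  qed
  have pt: "(\<lambda>m. f m x) sums (indicator {0..} x * (exp (- (s * x)) * bessel_riesz \<nu> x))" 
    and abs: "summable (\<lambda>m. norm (f m x))" if "x \<noteq> 0" for x
  proof -
    have f_eq: "f m x = (indicator {0..} x * (exp (- (s * x)) * x powr \<nu>)) * (bessel_coeff \<nu> m * x ^ m)" for m
      using that by (auto simp: f_def indicator_def powr_add powr_realpow)
    show "(\<lambda>m. f m x) sums (indicator {0..} x * (exp (- (s * x)) * bessel_riesz \<nu> x))"
      unfolding f_eq using sums_mult[OF bessel_entire_sums[OF \<nu>, of x], of "indicator {0..} x * (exp (- (s * x)) * x powr \<nu>)"]
      by (simp add: bessel_riesz_def mult.assoc)
    show "summable (\<lambda>m. norm (f m x))"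
      unfolding f_eq norm_mult[of "indicator {0..} x * (exp (- (s * x)) * x powr \<nu>)"]
      by (intro summable_mult summable_bessel_coeff \<nu>)
  qed
  have "(LINT x:{0..}|lborel. exp (- (s * x)) *\<^sub>R bessel_riesz \<nu> x) = (\<integral>x. (\<Sum>m. f m x) \<partial>lborel)"
    unfolding set_lebesgue_integral_def
  proof (rule integral_cong_AE)
    have [measurable]: "f m \<in> borel_measurable borel" for m unfolding f_def by measurable
    show "(\<lambda>x. \<Sum>m. f m x) \<in> borel_measurable lborel" by measurable
    show "(\<lambda>x. indicat_real {0..} x *\<^sub>R exp (- (s * x)) *\<^sub>R bessel_riesz \<nu> x) \<in> borel_measurable lborel"
      using borel_measurable_continuous_on_indicator[OF _ continuous_on_scaleR[OF _
          \<open>continuous_on {0..} (bessel_riesz \<nu>)\<close>], of "\<lambda>x. exp (- (s * x))"]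
      by (simp add: continuous_intros)
    show "AE x in lborel. indicat_real {0..} x *\<^sub>R exp (- (s * x)) *\<^sub>R bessel_riesz \<nu> x = (\<Sum>m. f m x)"
      using AE_lborel_singleton[of 0] by eventually_elim (use pt in \<open>auto simp: sums_iff\<close>)
  qed
  also have "\<dots> = (\<Sum>m. \<integral>x. f m x \<partial>lborel)"
  proof (rule integral_suminf)
    show "integrable lborel (f m)" for m
      unfolding f_def using hbi[of m] by (auto simp: has_bochner_integral_iff)
    show "AE x in lborel. summable (\<lambda>m. norm (f m x))"
      using AE_lborel_singleton[of 0] by eventually_elim (rule abs)
    show "summable (\<lambda>m. \<integral>x. norm (f m x) \<partial>lborel)"
      unfolding int_norm by (intro summable_mult summable_exp_generic)
  qed
  also have "\<dots> = exp (- (1 / s)) * s powr (- \<nu> - 1)"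
    unfolding int by (subst suminf_mult[OF summable_exp_generic]) (simp add: exp_def)
  finally show "(LINT x:{0..}|lborel. exp (- (s * x)) *\<^sub>R bessel_riesz \<nu> x) = exp (- (1 / s)) * s powr (- \<nu> - 1)" .
qed

lemma laplace_pair_bessel_riesz_scaled:
  assumes "\<nu> > 1 / 2" "b > 0"
  shows "laplace_pair (\<lambda>x. b powr (- \<nu>) * bessel_riesz \<nu> (b * x)) (\<lambda>s. exp (- (b / s)) * s powr (- \<nu> - 1))"
proof (rule laplace_pair_cong[OF laplace_pair_mult[OF laplace_pair_scale[OF laplace_pair_bessel_riesz[OF assms(1)] assms(2)], of "b powr (- \<nu>)"]])
  fix s :: real assume s: "s > 0"
  have "b powr (- \<nu>) * (s / b) powr (- \<nu> - 1) = b * s powr (- \<nu> - 1)"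
    using s assms by (simp add: powr_divide powr_diff powr_minus field_simps)
  thus "b powr (- \<nu>) * ((exp (- (1 / (s / b))) * (s / b) powr (- \<nu> - 1)) /\<^sub>R b) = exp (- (b / s)) * s powr (- \<nu> - 1)"
    using assms by (simp add: field_simps)
qed auto

subsection \<open>Kernels of the incomplete Gamma function\<close>

lemma integrable_powr_ge_1:
  fixes e :: real
  assumes "e < - 1"
  shows "integrable lborel (\<lambda>u. indicator {1..} u * u powr e)"
proof -
  have "(\<lambda>u. u powr e) integrable_on {1..}"
    using has_integral_powr_to_inf[of e 1] assms by (auto simp: integrable_on_def)
  hence "(\<lambda>u. u powr e) absolutely_integrable_on {1..}"
    by (rule nonnegative_absolutely_integrable_1) auto
  hence "integrable lebesgue (\<lambda>u. indicator {1..} u * u powr e)"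
    by (simp add: set_integrable_def)
  thus ?thesis
    by (subst (asm) integrable_completion) auto
qed

lemma integrable_incomplete_Gamma_kernel:
  fixes k s :: real
  assumes "s > 0"
  shows "integrable lborel (\<lambda>u. indicator {1..} u * (u powr (- k) * exp (- (2 * s * u))))"
proof (rule Bochner_Integration.integrable_bound)
  define m where "m = nat \<lceil>\<bar>k\<bar>\<rceil>"
  show "integrable lborel (\<lambda>x. indicator {0..} x * (exp (- (2 * s * x)) * (1 + x) ^ m))"
    using integrable_poly_exp[of "2 * s" m] assms by simp
  have "u powr (- k) \<le> (1 + u) ^ m" if "u \<ge> 1" for u
  proof -
    have "u powr (- k) \<le> u powr real m"
      using that unfolding m_def by (intro powr_mono) linarith+
    also have "\<dots> \<le> (1 + u) ^ m"
      using that by (simp add: powr_realpow power_mono)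
    finally show ?thesis .
  qed
  thus "AE u in lborel. norm (indicator {1..} u * (u powr (- k) * exp (- (2 * s * u)))) \<le>
          norm (indicator {0..} u * (exp (- (2 * s * u)) * (1 + u) ^ m))"
    by (intro AE_I2) (auto simp: indicator_def abs_mult mult.commute intro!: mult_left_mono)
qed auto

text \<open>Substitute t = 2su. The factor exp s, which comes from q^(- n), lowers the exponent 2su
  to (2u - 1)s; since u \<ge> 1 this is a genuine decay, and in the variable s a delay by at least
  1.\<close>

lemma incomplete_Gamma_integral:
  fixes k s :: real
  assumes "s > 0"
  shows "(\<integral>u. indicator {1..} u * (u powr (- k) * 2 powr (1 - k) * exp (- ((2 * u - 1) * s))) \<partial>lborel) =
           s powr (k - 1) * exp s * incomplete_Gamma (1 - k) (2 * s)"
proof -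
  define f where "f = (\<lambda>t::real. indicator {2 * s..} t * (t powr (1 - k - 1) * exp (- t)))"
  have f_eq: "f (0 + 2 * s * u) = (2 * s) powr (- k) * (indicator {1..} u * (u powr (- k) * exp (- (2 * s * u))))" for u
  proof (cases "u \<ge> 1")
    case True
    thus ?thesis using assms by (simp add: f_def powr_mult)
  next
    case False
    hence "\<not> 2 * s \<le> 2 * s * u" using assms by (simp add: mult_le_cancel_left1)
    thus ?thesis using False by (simp add: f_def)
  qed
  have "integrable lborel (\<lambda>u. f (0 + 2 * s * u))"
    unfolding f_eq using integrable_incomplete_Gamma_kernel[OF assms] by simp
  \<comment> \<open>\<open>incomplete_Gamma\<close> is a gauge integral; this integrability permits
    replacing it by the Lebesgue integral.\<close>
  hence "set_integrable lborel {2 * s..} (\<lambda>t. t powr (1 - k - 1) * exp (- t))"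
    using assms by (subst (asm) lborel_integrable_real_affine_iff) (auto simp: f_def set_integrable_def)
  from set_borel_integral_eq_integral(2)[OF this]
  have "incomplete_Gamma (1 - k) (2 * s) = (\<integral>t. f t \<partial>lborel)"
    by (simp add: incomplete_Gamma_def f_def set_lebesgue_integral_def)
  also have "\<dots> = 2 * s * (\<integral>u. f (0 + 2 * s * u) \<partial>lborel)"
    using assms by (subst lborel_integral_real_affine[of "2 * s" _ 0]) auto
  finally have 1: "incomplete_Gamma (1 - k) (2 * s) =
      (2 * s) powr (1 - k) * (\<integral>u. indicator {1..} u * (u powr (- k) * exp (- (2 * s * u))) \<partial>lborel)"
    unfolding f_eq integral_mult_right_zero
    using assms by (simp add: powr_diff powr_minus_divide del: integral_mult_right_zero)
  have "(\<integral>u. indicator {1..} u * (u powr (- k) * 2 powr (1 - k) * exp (- ((2 * u - 1) * s))) \<partial>lborel) =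
        (\<integral>u. (2 powr (1 - k) * exp s) * (indicator {1..} u * (u powr (- k) * exp (- (2 * s * u)))) \<partial>lborel)"
    by (intro Bochner_Integration.integral_cong) (auto simp: algebra_simps exp_diff exp_minus field_simps)
  also have "\<dots> = 2 powr (1 - k) * exp s * (\<integral>u. indicator {1..} u * (u powr (- k) * exp (- (2 * s * u))) \<partial>lborel)"
    by simp
  also have "\<dots> = s powr (k - 1) * exp s * incomplete_Gamma (1 - k) (2 * s)"
    unfolding 1 using assms by (simp add: powr_mult powr_diff field_simps)
  finally show ?thesis .
qed

text \<open>The kernels of the nonholomorphic parts come from writing \<open>\<Gamma>(1 - k, 2z)\<close> as the integral over
  \<open>u \<ge> 1\<close> of \<open>(2z)^(1 - k) u^(- k) exp (- 2zu)\<close> and inverting the Laplace transform under the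
  integral, for \<open>z = s\<close> here and for \<open>z = 1/s\<close> in \<open>bessel_tail\<close>.\<close>
definition riesz_tail :: "real \<Rightarrow> real \<Rightarrow> real \<Rightarrow> real" where
  "riesz_tail k p y = (\<integral>u. indicator {1..} u * (u powr (- k) * 2 powr (1 - k)) *
     (max 0 (y - (2 * u - 1)) powr p / Gamma (p + 1)) \<partial>lborel)"

lemma laplace_pair_riesz_tail:
  assumes "p > 0"
  shows "laplace_pair (riesz_tail k p)
           (\<lambda>s. s powr (- p - 1) * (s powr (k - 1) * exp s * incomplete_Gamma (1 - k) (2 * s)))"
proof -
  \<comment> \<open>The integrand vanishes unless 2u - 1 < x, and then u \<le> 1 + x. So a decay
    u^(- L) can be bought for the price (1 + x)^L, and this L makes - k - L < - 1.\<close>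
  define L where "L = nat \<lceil>\<bar>k\<bar>\<rceil> + 2"
  define P where "P = nat \<lceil>p\<rceil>"
  have G: "Gamma (p + 1) > 0" using assms by (intro Gamma_real_pos) auto
  have "laplace_pair (\<lambda>y. \<integral>u. indicator {1..} u * (u powr (- k) * 2 powr (1 - k)) *
     (max 0 (y - (2 * u - 1)) powr p / Gamma (p + 1)) \<partial>lborel)
     (\<lambda>s. \<integral>u. indicator {1..} u * (u powr (- k) * 2 powr (1 - k)) *
        (exp (- ((2 * u - 1) * s)) *\<^sub>R s powr (- p - 1)) \<partial>lborel)"
  proof (rule laplace_pair_integral[where m = "L + P" and
        c = "\<lambda>u. 2 powr (1 - k) / Gamma (p + 1) * (indicator {1..} u * u powr (- k - real L))"])
    show "integrable lborel (\<lambda>u. 2 powr (1 - k) / Gamma (p + 1) * (indicator {1..} u * u powr (- k - real L)))"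
      by (intro integrable_mult_right integrable_powr_ge_1) (auto simp: L_def, linarith)
    show "laplace_pair (\<lambda>y. indicator {1..} u * (u powr (- k) * 2 powr (1 - k)) *
            (max 0 (y - (2 * u - 1)) powr p / Gamma (p + 1)))
         (\<lambda>s. indicator {1..} u * (u powr (- k) * 2 powr (1 - k)) *
            (exp (- ((2 * u - 1) * s)) *\<^sub>R s powr (- p - 1)))" for u
    proof (cases "u \<ge> 1")
      case True
      show ?thesis
        by (intro laplace_pair_mult laplace_pair_shift[OF laplace_pair_powr[OF assms]])
           (use True assms in auto)
    next
      case False
      thus ?thesis
        using laplace_pair_mult[OF laplace_pair_powr[OF assms], of 0] by simp
    qed
    fix u x :: real assume "x \<ge> 0"
    show "norm (indicator {1..} u * (u powr (- k) * 2 powr (1 - k)) *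
            (max 0 (x - (2 * u - 1)) powr p / Gamma (p + 1))) \<le>
          2 powr (1 - k) / Gamma (p + 1) * (indicator {1..} u * u powr (- k - real L)) * (1 + x) ^ (L + P)"
    proof (cases "u \<ge> 1 \<and> 2 * u - 1 < x")
      case True
      have "(x - (2 * u - 1)) powr p \<le> (1 + x) powr p"
        using True assms by (intro powr_mono2) auto
      also have "\<dots> \<le> (1 + x) powr real P"
        using \<open>x \<ge> 0\<close> by (intro powr_mono) (auto simp: P_def, linarith)
      also have "\<dots> \<le> 1 * (1 + x) ^ P" using \<open>x \<ge> 0\<close> by (simp add: powr_realpow)
      also have "\<dots> \<le> ((1 + x) / u) ^ L * (1 + x) ^ P"
        using True by (intro mult_right_mono one_le_power) auto
      also have "\<dots> = u powr (- real L) * (1 + x) ^ (L + P)"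
        using True by (simp add: powr_minus powr_realpow power_mult_distrib power_inverse power_add divide_inverse)
      finally have "(x - (2 * u - 1)) powr p \<le> u powr (- real L) * (1 + x) ^ (L + P)" .
      hence "(u powr (- k) * 2 powr (1 - k) / Gamma (p + 1)) * (x - (2 * u - 1)) powr p \<le>
        (u powr (- k) * 2 powr (1 - k) / Gamma (p + 1)) * (u powr (- real L) * (1 + x) ^ (L + P))"
        using G by (intro mult_left_mono) auto
      also have "\<dots> = 2 powr (1 - k) / Gamma (p + 1) * u powr (- k - real L) * (1 + x) ^ (L + P)"
        by (simp add: powr_diff powr_minus field_simps)
      finally show ?thesis using True G by (simp add: abs_mult max_def)
    next
      case False
      hence "norm (indicator {1..} u * (u powr (- k) * 2 powr (1 - k)) *
            (max 0 (x - (2 * u - 1)) powr p / Gamma (p + 1))) = 0"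
        using assms by (auto simp: indicator_def max_def)
      also have "\<dots> \<le> 2 powr (1 - k) / Gamma (p + 1) * (indicator {1..} u * u powr (- k - real L)) * (1 + x) ^ (L + P)"
        using G \<open>x \<ge> 0\<close> by auto
      finally show ?thesis .
    qed
  qed (auto intro: sigma_finite_lborel)
  thus ?thesis
  proof (rule laplace_pair_cong)
    fix s :: real assume s: "s > 0"
    have "(\<integral>u. indicator {1..} u * (u powr (- k) * 2 powr (1 - k)) *
            (exp (- ((2 * u - 1) * s)) *\<^sub>R s powr (- p - 1)) \<partial>lborel) =
          (\<integral>u. s powr (- p - 1) * (indicator {1..} u * (u powr (- k) * 2 powr (1 - k) * exp (- ((2 * u - 1) * s)))) \<partial>lborel)"
      by (intro Bochner_Integration.integral_cong) auto
    also have "\<dots> = s powr (- p - 1) * (s powr (k - 1) * exp s * incomplete_Gamma (1 - k) (2 * s))"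
      by (simp add: incomplete_Gamma_integral[OF s])
    finally show "(\<integral>u. indicator {1..} u * (u powr (- k) * 2 powr (1 - k)) *
            (exp (- ((2 * u - 1) * s)) *\<^sub>R s powr (- p - 1)) \<partial>lborel) =
          s powr (- p - 1) * (s powr (k - 1) * exp s * incomplete_Gamma (1 - k) (2 * s))" .
  qed (simp add: riesz_tail_def)
qed

text \<open>All delays 2u - 1 are at least 1. With y = x/n this cuts the sum over n off at n \<le>
  x.\<close>

lemma riesz_tail_eq_0:
  assumes "y \<le> 1"
  shows "riesz_tail k p y = 0"
proof -
  have "riesz_tail k p y = (\<integral>u. 0 \<partial>(lborel :: real measure))"
    unfolding riesz_tail_def using assms
    by (intro Bochner_Integration.integral_cong) (auto simp: indicator_def max_def)
  thus ?thesis by simp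
qed

text \<open>The substitution t = 2u/(y + 1) maps the support, u from 1 to (y + 1)/2, to the interval
  from 2/(y + 1) to 1 and produces the incomplete Beta integral of g_\<rho>.\<close>

lemma riesz_tail_eq:
  assumes "p > 0" "y \<ge> 1"
  shows "riesz_tail k p y = (y + 1) powr (p + 1 - k) / Gamma (p + 1) *
           integral {2 / (y + 1)..1} (\<lambda>t. t powr (- k) * (1 - t) powr p)"
proof -
  define c where "c = 2 / (y + 1)"
  have c: "c > 0" using assms by (simp add: c_def)
  define f where "f = (\<lambda>t::real. indicator {c..1} t * (t powr (- k) * (1 - t) powr p))"
  have "continuous_on {c..1} (\<lambda>t. t powr (- k) * (1 - t) powr p)"
    using c assms by (intro continuous_on_mult continuous_on_powr' continuous_intros) auto
  hence "set_integrable lborel {c..1} (\<lambda>t. t powr (- k) * (1 - t) powr p)"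
    by (rule borel_integrable_atLeastAtMost')
  from set_borel_integral_eq_integral(2)[OF this]
  have "integral {c..1} (\<lambda>t. t powr (- k) * (1 - t) powr p) = (\<integral>t. f t \<partial>lborel)"
    by (simp add: f_def set_lebesgue_integral_def)
  also have "\<dots> = c * (\<integral>u. f (0 + c * u) \<partial>lborel)"
    using c by (subst lborel_integral_real_affine[of c _ 0]) auto
  also have "(\<lambda>u. f (0 + c * u)) = (\<lambda>u. (c powr (- k) * (y + 1) powr (- p) * Gamma (p + 1) * 2 powr (k - 1)) *
     (indicator {1..} u * (u powr (- k) * 2 powr (1 - k)) * (max 0 (y - (2 * u - 1)) powr p / Gamma (p + 1))))"
  proof
    fix u :: real
    have G: "Gamma (p + 1) > 0" using assms by (intro Gamma_real_pos) auto
    have "c \<le> c * u \<longleftrightarrow> 1 \<le> u" using c by simp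
    moreover have "c * u \<le> 1 \<longleftrightarrow> 2 * u \<le> y + 1"
      using assms by (simp add: c_def pos_divide_le_eq)
    ultimately have mem: "c * u \<in> {c..1} \<longleftrightarrow> 1 \<le> u \<and> 2 * u \<le> y + 1" by simp
    show "f (0 + c * u) = (c powr (- k) * (y + 1) powr (- p) * Gamma (p + 1) * 2 powr (k - 1)) *
     (indicator {1..} u * (u powr (- k) * 2 powr (1 - k)) * (max 0 (y - (2 * u - 1)) powr p / Gamma (p + 1)))"
    proof (cases "1 \<le> u \<and> 2 * u \<le> y + 1")
      case True
      have "1 - c * u = (y + 1 - 2 * u) / (y + 1)"
        using assms by (simp add: c_def field_simps)
      hence "(1 - c * u) powr p = (y + 1 - 2 * u) powr p * (y + 1) powr (- p)"
        using True assms by (simp add: powr_divide powr_minus_divide)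
      moreover have "(c * u) powr (- k) = c powr (- k) * u powr (- k)"
        using c True by (simp add: powr_mult)
      ultimately have lhs: "f (0 + c * u) =
          c powr (- k) * u powr (- k) * ((y + 1 - 2 * u) powr p * (y + 1) powr (- p))"
        using True mem by (simp add: f_def)
      define A where "A = (2::real) powr (k - 1)"
      define B where "B = (2::real) powr (1 - k)"
      have "A * B = 1" by (simp add: A_def B_def powr_add[symmetric])
      moreover have "max 0 (y - (2 * u - 1)) = y + 1 - 2 * u" using True by auto
      ultimately show ?thesis
        unfolding lhs A_def[symmetric] B_def[symmetric] using True G by (simp add: field_simps)
    next
      case False
      thus ?thesis using mem by (auto simp: f_def indicator_def max_def)
    qed
  qed
  also have "(\<integral>u. (c powr (- k) * (y + 1) powr (- p) * Gamma (p + 1) * 2 powr (k - 1)) *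
     (indicator {1..} u * (u powr (- k) * 2 powr (1 - k)) * (max 0 (y - (2 * u - 1)) powr p / Gamma (p + 1))) \<partial>lborel)
     = (c powr (- k) * (y + 1) powr (- p) * Gamma (p + 1) * 2 powr (k - 1)) * riesz_tail k p y"
    unfolding riesz_tail_def by (rule integral_mult_right_zero)
  finally have eq: "integral {c..1} (\<lambda>t. t powr (- k) * (1 - t) powr p) =
     (c * c powr (- k) * (y + 1) powr (- p) * 2 powr (k - 1)) * Gamma (p + 1) * riesz_tail k p y"
    by (simp add: mult_ac)
  have "(y + 1) powr (p + 1 - k) * (c * c powr (- k) * (y + 1) powr (- p) * 2 powr (k - 1)) = 1"
  proof -
    define Y where "Y = y + 1"
    have "Y > 0" using assms by (simp add: Y_def)
    thus ?thesis
      unfolding c_def Y_def[symmetric]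
      by (simp add: powr_divide powr_diff powr_minus powr_add field_simps)
  qed
  moreover have "Gamma (p + 1) > 0" using assms by (intro Gamma_real_pos) auto
  ultimately show ?thesis
    unfolding c_def[symmetric] eq
    by (simp add: mult.assoc[symmetric])
qed

text \<open>For p = k + \<rho> - 1 the prefactor exponent p + 1 - k is \<rho>, and n (x/n + 1) = x
  (1 + n/x) rearranges the prefactor into that of g_\<rho>.\<close>

lemma riesz_tail_g_kernel:
  assumes "k + \<rho> > 1" "n > 0" "x \<ge> 0"
  shows "complex_of_real (real n powr \<rho> * riesz_tail k (k + \<rho> - 1) (x / real n)) =
     (if real n \<le> x then complex_of_real (x powr \<rho>) / (2 * complex_of_real pi * \<i>) * g_kernel k \<rho> n x else 0)"
proof (cases "real n \<le> x")
  case True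
  have "x > 0" using True assms by linarith
  define I where "I = integral {2 * real n / (x + real n)..1} (\<lambda>t. t powr (- k) * (1 - t) powr (k + \<rho> - 1))"
  have "2 / (x / real n + 1) = 2 * real n / (x + real n)"
    using assms \<open>x > 0\<close> by (simp add: field_simps)
  hence "riesz_tail k (k + \<rho> - 1) (x / real n) = (x / real n + 1) powr \<rho> / Gamma (k + \<rho>) * I"
    using riesz_tail_eq[of "k + \<rho> - 1" "x / real n" k] assms True by (simp add: I_def)
  moreover have "real n powr \<rho> * (x / real n + 1) powr \<rho> = x powr \<rho> * (1 + real n / x) powr \<rho>"
  proof -
    have "real n * (x / real n + 1) = x * (1 + real n / x)"
      using assms \<open>x > 0\<close> by (simp add: distrib_left)
    thus ?thesis using assms \<open>x > 0\<close> by (simp only: powr_mult[symmetric])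
  qed
  ultimately have "real n powr \<rho> * riesz_tail k (k + \<rho> - 1) (x / real n) =
     x powr \<rho> * ((1 + real n / x) powr \<rho> * I) / Gamma (k + \<rho>)"
    by (simp add: mult_ac)
  thus ?thesis
    using True by (simp add: g_kernel_def I_def field_simps)
next
  case False
  thus ?thesis using assms by (simp add: riesz_tail_eq_0)
qed

section \<open>The Bessel kernel of the nonholomorphic terms of g\<close>

lemma measurable_bessel_riesz:
  assumes "\<nu> \<ge> 0"
  shows "bessel_riesz \<nu> \<in> borel_measurable borel"
proof -
  have "continuous_on UNIV (bessel_entire \<nu>)"
    by (meson DERIV_isCont bessel_entire_has_derivative continuous_at_imp_continuous_on assms)
  hence [measurable]: "bessel_entire \<nu> \<in> borel_measurable borel"
    by (rule borel_measurable_continuous_onI)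
  show ?thesis unfolding bessel_riesz_def[abs_def] by measurable
qed

text \<open>The index is \<rho> + 1 for every k: at the point 1/s the integral representation
  supplies a factor s^(k - 1), which turns s^(- \<rho> - k - 1) into s^(- \<rho> - 2). The delays of
  \<open>riesz_tail\<close> become the scales 2u - 1 of a Bessel function.\<close>

definition bessel_tail :: "real \<Rightarrow> real \<Rightarrow> real \<Rightarrow> real" where
  "bessel_tail k \<rho> y = (\<integral>u. indicator {1..} u * (u powr (- k) * 2 powr (1 - k)) *
     ((2 * u - 1) powr (- (\<rho> + 1)) * bessel_riesz (\<rho> + 1) ((2 * u - 1) * y)) \<partial>lborel)"

text \<open>The pure power bound for index \<rho> + 1 leaves (2u - 1)^(- \<rho>/2 - 3/4), and 2u - 1
  \<ge> u passes to a power of u. The total exponent - k - \<rho>/2 - 3/4 is below - 1 exactly when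
  k + \<rho>/2 > 1/4, the condition of the lemmas that integrate this bound.\<close>

lemma bessel_tail_kernel_bound:
  assumes "\<rho> > - 1"
  obtains C where "C \<ge> 0"
    "\<And>u y. y \<ge> 0 \<Longrightarrow>
       \<bar>indicator {1..} u * (u powr (- k) * 2 powr (1 - k)) *
         ((2 * u - 1) powr (- (\<rho> + 1)) * bessel_riesz (\<rho> + 1) ((2 * u - 1) * y))\<bar> \<le>
       C * (indicator {1..} u * u powr (- k - \<rho> / 2 - 3 / 4)) * y powr (\<rho> / 2 + 1 / 4)"
proof -
  obtain C where C: "C \<ge> 0" "\<And>x. x \<ge> 0 \<Longrightarrow> \<bar>bessel_riesz (\<rho> + 1) x\<bar> \<le> C * x powr ((\<rho> + 1) / 2 - 1 / 4)"
    using bessel_riesz_bound[of "\<rho> + 1"] assms by auto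
  have e: "(\<rho> + 1) / 2 - 1 / 4 = \<rho> / 2 + 1 / 4" by (simp add: field_simps)
  show ?thesis
  proof (rule that[of "C * 2 powr (1 - k)"])
    fix u y :: real assume y: "y \<ge> 0"
    show "\<bar>indicator {1..} u * (u powr (- k) * 2 powr (1 - k)) *
         ((2 * u - 1) powr (- (\<rho> + 1)) * bessel_riesz (\<rho> + 1) ((2 * u - 1) * y))\<bar> \<le>
       C * 2 powr (1 - k) * (indicator {1..} u * u powr (- k - \<rho> / 2 - 3 / 4)) * y powr (\<rho> / 2 + 1 / 4)"
    proof (cases "u \<ge> 1")
      case True
      define v where "v = 2 * u - 1"
      have v: "v \<ge> u" "v > 0" using True by (auto simp: v_def)
      have "v powr (- (\<rho> + 1)) * \<bar>bessel_riesz (\<rho> + 1) (v * y)\<bar> \<le>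
            v powr (- (\<rho> + 1)) * (C * (v * y) powr (\<rho> / 2 + 1 / 4))"
        using C(2)[of "v * y"] v y unfolding e by (intro mult_left_mono) auto
      also have "\<dots> = C * v powr (- \<rho> / 2 - 3 / 4) * y powr (\<rho> / 2 + 1 / 4)"
      proof -
        have "- \<rho> / 2 - 3 / 4 = - (\<rho> + 1) + (\<rho> / 2 + 1 / 4)" by (simp add: field_simps)
        hence "v powr (- \<rho> / 2 - 3 / 4) = v powr (- (\<rho> + 1)) * v powr (\<rho> / 2 + 1 / 4)"
          by (simp only: powr_add)
        thus ?thesis using v y by (simp add: powr_mult)
      qed
      also have "\<dots> \<le> C * u powr (- \<rho> / 2 - 3 / 4) * y powr (\<rho> / 2 + 1 / 4)"
        using C(1) v True assms by (intro mult_right_mono mult_left_mono powr_mono2') auto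
      finally have "(u powr (- k) * 2 powr (1 - k)) * (v powr (- (\<rho> + 1)) * \<bar>bessel_riesz (\<rho> + 1) (v * y)\<bar>) \<le>
        (u powr (- k) * 2 powr (1 - k)) * (C * u powr (- \<rho> / 2 - 3 / 4) * y powr (\<rho> / 2 + 1 / 4))"
        by (intro mult_left_mono) auto
      also have "\<dots> = C * 2 powr (1 - k) * (u powr (- k) * u powr (- \<rho> / 2 - 3 / 4)) * y powr (\<rho> / 2 + 1 / 4)"
        by (simp add: mult_ac)
      also have "u powr (- k) * u powr (- \<rho> / 2 - 3 / 4) = u powr (- k - \<rho> / 2 - 3 / 4)"
        by (simp add: powr_add[symmetric] add_diff_eq)
      finally show ?thesis using True by (simp add: abs_mult v_def)
    qed auto
  qed (use C(1) in auto)
qed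

lemma laplace_pair_bessel_tail:
  assumes "\<rho> > 0" "k + \<rho> / 2 > 1 / 4"
  shows "laplace_pair (bessel_tail k \<rho>)
           (\<lambda>s. s powr (- \<rho> - k - 1) * (exp (1 / s) * incomplete_Gamma (1 - k) (2 / s)))"
proof -
  obtain C where C: "C \<ge> 0" "\<And>u y. y \<ge> 0 \<Longrightarrow>
       \<bar>indicator {1..} u * (u powr (- k) * 2 powr (1 - k)) *
         ((2 * u - 1) powr (- (\<rho> + 1)) * bessel_riesz (\<rho> + 1) ((2 * u - 1) * y))\<bar> \<le>
       C * (indicator {1..} u * u powr (- k - \<rho> / 2 - 3 / 4)) * y powr (\<rho> / 2 + 1 / 4)"
    using bessel_tail_kernel_bound[of \<rho> k] assms by auto
  define m where "m = nat \<lceil>\<rho> / 2 + 1 / 4\<rceil>"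
  have "laplace_pair (\<lambda>y. \<integral>u. indicator {1..} u * (u powr (- k) * 2 powr (1 - k)) *
     ((2 * u - 1) powr (- (\<rho> + 1)) * bessel_riesz (\<rho> + 1) ((2 * u - 1) * y)) \<partial>lborel)
     (\<lambda>s. \<integral>u. indicator {1..} u * (u powr (- k) * 2 powr (1 - k)) *
        (exp (- ((2 * u - 1) / s)) * s powr (- (\<rho> + 1) - 1)) \<partial>lborel)"
  proof (rule laplace_pair_integral[where m = m and
        c = "\<lambda>u. C * (indicator {1..} u * u powr (- k - \<rho> / 2 - 3 / 4))"])
    show "integrable lborel (\<lambda>u. C * (indicator {1..} u * u powr (- k - \<rho> / 2 - 3 / 4)))"
      using assms by (intro integrable_mult_right integrable_powr_ge_1) auto
    show "laplace_pair (\<lambda>y. indicator {1..} u * (u powr (- k) * 2 powr (1 - k)) *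
            ((2 * u - 1) powr (- (\<rho> + 1)) * bessel_riesz (\<rho> + 1) ((2 * u - 1) * y)))
         (\<lambda>s. indicator {1..} u * (u powr (- k) * 2 powr (1 - k)) *
            (exp (- ((2 * u - 1) / s)) * s powr (- (\<rho> + 1) - 1)))" for u
    proof (cases "u \<ge> 1")
      case True
      thus ?thesis
        using assms by (intro laplace_pair_mult laplace_pair_bessel_riesz_scaled) auto
    next
      case False
      thus ?thesis
        using laplace_pair_mult[OF laplace_pair_powr[OF assms(1)], of 0] by simp
    qed
    show "(\<lambda>(u, y). indicat_real {0..} y *\<^sub>R (indicat_real {1..} u * (u powr (- k) * 2 powr (1 - k)) *
            ((2 * u - 1) powr (- (\<rho> + 1)) * bessel_riesz (\<rho> + 1) ((2 * u - 1) * y))))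
        \<in> borel_measurable (lborel \<Otimes>\<^sub>M lborel)"
    proof -
      have [measurable]: "bessel_riesz (\<rho> + 1) \<in> borel_measurable borel"
        using assms by (intro measurable_bessel_riesz) auto
      show ?thesis by measurable
    qed
    fix u x :: real assume x: "x \<ge> 0"
    have "x powr (\<rho> / 2 + 1 / 4) \<le> (1 + x) powr (\<rho> / 2 + 1 / 4)"
      using x assms by (intro powr_mono2) auto
    also have "\<dots> \<le> (1 + x) powr real m"
      using x by (intro powr_mono) (auto simp: m_def, linarith)
    also have "\<dots> = (1 + x) ^ m" using x by (simp add: powr_realpow)
    finally show "norm (indicator {1..} u * (u powr (- k) * 2 powr (1 - k)) *
            ((2 * u - 1) powr (- (\<rho> + 1)) * bessel_riesz (\<rho> + 1) ((2 * u - 1) * x))) \<le>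
          C * (indicator {1..} u * u powr (- k - \<rho> / 2 - 3 / 4)) * (1 + x) ^ m"
      using C(1) by (intro order.trans[OF C(2)[OF x, of u, folded real_norm_def]] mult_left_mono) auto
  qed (auto intro: sigma_finite_lborel)
  thus ?thesis
  proof (rule laplace_pair_cong)
    fix s :: real assume s: "s > 0"
    have "(\<integral>u. indicator {1..} u * (u powr (- k) * 2 powr (1 - k)) *
            (exp (- ((2 * u - 1) / s)) * s powr (- (\<rho> + 1) - 1)) \<partial>lborel) =
          (\<integral>u. s powr (- (\<rho> + 1) - 1) * (indicator {1..} u * (u powr (- k) * 2 powr (1 - k) * exp (- ((2 * u - 1) * (1 / s))))) \<partial>lborel)"
      by (intro Bochner_Integration.integral_cong) auto
    also have "\<dots> = s powr (- (\<rho> + 1) - 1) * ((1 / s) powr (k - 1) * exp (1 / s) * incomplete_Gamma (1 - k) (2 * (1 / s)))"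
      using s by (subst incomplete_Gamma_integral[symmetric]) auto
    also have "(1 / s) powr (k - 1) = s powr (1 - k)"
      using s by (simp add: powr_divide powr_diff field_simps)
    also have "s powr (- (\<rho> + 1) - 1) * (s powr (1 - k) * exp (1 / s) * incomplete_Gamma (1 - k) (2 * (1 / s)))
        = (s powr (- (\<rho> + 1) - 1) * s powr (1 - k)) * (exp (1 / s) * incomplete_Gamma (1 - k) (2 / s))"
      by simp
    also have "s powr (- (\<rho> + 1) - 1) * s powr (1 - k) = s powr (- \<rho> - k - 1)"
      by (simp add: powr_add[symmetric])
    finally show "(\<integral>u. indicator {1..} u * (u powr (- k) * 2 powr (1 - k)) *
            (exp (- ((2 * u - 1) / s)) * s powr (- (\<rho> + 1) - 1)) \<partial>lborel) =
          s powr (- \<rho> - k - 1) * (exp (1 / s) * incomplete_Gamma (1 - k) (2 / s))" .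
  qed (simp add: bessel_tail_def)
qed

lemma bessel_tail_bound:
  assumes "\<rho> > 0" "k + \<rho> / 2 > 1 / 4"
  obtains C where "C \<ge> 0" "\<And>y. y \<ge> 0 \<Longrightarrow> \<bar>bessel_tail k \<rho> y\<bar> \<le> C * y powr (\<rho> / 2 + 1 / 4)"
proof -
  obtain C where C: "C \<ge> 0" "\<And>u y. y \<ge> 0 \<Longrightarrow>
       \<bar>indicator {1..} u * (u powr (- k) * 2 powr (1 - k)) *
         ((2 * u - 1) powr (- (\<rho> + 1)) * bessel_riesz (\<rho> + 1) ((2 * u - 1) * y))\<bar> \<le>
       C * (indicator {1..} u * u powr (- k - \<rho> / 2 - 3 / 4)) * y powr (\<rho> / 2 + 1 / 4)"
    using bessel_tail_kernel_bound[of \<rho> k] assms by auto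
  define J where "J = (\<integral>u. indicator {1..} u * u powr (- k - \<rho> / 2 - 3 / 4) \<partial>lborel)"
  have J: "integrable lborel (\<lambda>u. indicator {1..} u * u powr (- k - \<rho> / 2 - 3 / 4))"
    using assms by (intro integrable_powr_ge_1) auto
  show ?thesis
  proof (rule that[of "C * J"])
    show "C * J \<ge> 0"
      unfolding J_def using C(1) by (intro mult_nonneg_nonneg Bochner_Integration.integral_nonneg) auto
    fix y :: real assume y: "y \<ge> 0"
    define h where "h = (\<lambda>u. indicator {1..} u * (u powr (- k) * 2 powr (1 - k)) *
         ((2 * u - 1) powr (- (\<rho> + 1)) * bessel_riesz (\<rho> + 1) ((2 * u - 1) * y)))"
    have dom: "integrable lborel (\<lambda>u. C * (indicator {1..} u * u powr (- k - \<rho> / 2 - 3 / 4)) * y powr (\<rho> / 2 + 1 / 4))"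
      using J by simp
    have [measurable]: "bessel_riesz (\<rho> + 1) \<in> borel_measurable borel"
      using assms by (intro measurable_bessel_riesz) auto
    have [measurable]: "h \<in> borel_measurable lborel"
      unfolding h_def by measurable
    have h: "\<bar>h u\<bar> \<le> C * (indicator {1..} u * u powr (- k - \<rho> / 2 - 3 / 4)) * y powr (\<rho> / 2 + 1 / 4)" for u
      unfolding h_def by (rule C(2)[OF y])
    have "integrable lborel h"
      by (rule Bochner_Integration.integrable_bound[OF dom \<open>h \<in> borel_measurable lborel\<close>],
          unfold real_norm_def) (intro AE_I2 order.trans[OF h abs_ge_self])
    hence "\<bar>\<integral>u. h u \<partial>lborel\<bar> \<le> (\<integral>u. C * (indicator {1..} u * u powr (- k - \<rho> / 2 - 3 / 4)) * y powr (\<rho> / 2 + 1 / 4) \<partial>lborel)"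
      by (intro order.trans[OF integral_abs_bound Bochner_Integration.integral_mono[OF _ dom h]]) auto
    thus "\<bar>bessel_tail k \<rho> y\<bar> \<le> C * J * y powr (\<rho> / 2 + 1 / 4)"
      by (simp add: bessel_tail_def h_def J_def)
  qed
qed

lemma laplace_pair_bessel_tail_scaled:
  assumes "\<rho> > 0" "k + \<rho> / 2 > 1 / 4" "b > 0"
  shows "laplace_pair (\<lambda>x. b powr (- \<rho> - k) * bessel_tail k \<rho> (b * x))
           (\<lambda>s. s powr (- \<rho> - k - 1) * (exp (b / s) * incomplete_Gamma (1 - k) (2 * b / s)))"
proof (rule laplace_pair_cong[OF laplace_pair_mult[OF laplace_pair_scale[OF laplace_pair_bessel_tail[OF assms(1,2)] assms(3)], of "b powr (- \<rho> - k)"]])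
  fix s :: real assume s: "s > 0"
  have "b powr (- \<rho> - k) * (s / b) powr (- \<rho> - k - 1) = b * s powr (- \<rho> - k - 1)"
    using s assms by (simp add: powr_divide powr_diff powr_minus powr_add field_simps)
  thus "b powr (- \<rho> - k) * (((s / b) powr (- \<rho> - k - 1) * (exp (1 / (s / b)) * incomplete_Gamma (1 - k) (2 / (s / b)))) /\<^sub>R b) =
      s powr (- \<rho> - k - 1) * (exp (b / s) * incomplete_Gamma (1 - k) (2 * b / s))"
    using assms by (simp add: field_simps)
qed auto

subsection \<open>Laplace transforms of the two sides of the Fricke relation\<close>

text \<open>From eventually to everywhere: as n^\<mu> \<ge> 1 for n \<ge> 1, enlarging the constant
  by the sum of the initial coefficients is enough. The index starts at 1 because
  \<open>0 powr \<mu> = 0\<close> cannot bound the constant coefficient.\<close>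

lemma coeff_bound_of_bigo:
  fixes c :: "nat \<Rightarrow> complex"
  assumes "c \<in> O(\<lambda>n. complex_of_real (real n powr \<mu>))" "\<mu> \<ge> 0"
  obtains C where "C \<ge> 0" "\<And>n. norm (c (Suc n)) \<le> C * real (Suc n) powr \<mu>"
proof -
  obtain C0 M where C0: "\<And>n. n \<ge> M \<Longrightarrow> norm (c n) \<le> C0 * real n powr \<mu>"
    using assms(1) by (elim landau_o.bigE) (auto simp: eventually_at_top_linorder)
  define C where "C = \<bar>C0\<bar> + (\<Sum>n\<le>M. norm (c n))"
  have nonneg: "(\<Sum>n\<le>M. norm (c n)) \<ge> 0" by (intro sum_nonneg) auto
  have "norm (c (Suc n)) \<le> C * real (Suc n) powr \<mu>" for n
  proof (cases "Suc n \<ge> M")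
    case True
    have "C0 \<le> C" using nonneg by (simp add: C_def)
    thus ?thesis using C0[OF True] by (meson mult_right_mono order.trans powr_ge_zero)
  next
    case False
    hence "norm (c (Suc n)) \<le> (\<Sum>n\<le>M. norm (c n))"
      by (intro member_le_sum) auto
    also have "\<dots> \<le> C * 1" by (simp add: C_def)
    also have "\<dots> \<le> C * real (Suc n) powr \<mu>"
      using nonneg assms(2) by (intro mult_left_mono ge_one_powr_ge_zero) (auto simp: C_def)
    finally show ?thesis .
  qed
  moreover have "C \<ge> 0" using nonneg by (simp add: C_def)
  ultimately show ?thesis using that by blast
qed

lemma summable_Suc_powr: "e < - 1 \<Longrightarrow> summable (\<lambda>n. real (Suc n) powr e)"
  by (subst summable_Suc_iff[of "\<lambda>n. real n powr e"]) (simp add: summable_real_powr_iff)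

text \<open>At each x only n < x can contribute, so n^(\<mu> + \<sigma> + 2) is at most a power of 1
  + x and the terms are dominated by n^(- 2). Thus any polynomial growth of the coefficients is
  admissible.\<close>

lemma laplace_pair_sum_below:
  fixes c :: "nat \<Rightarrow> complex"
  assumes pair: "laplace_pair h H" and zero: "\<And>y. 0 \<le> y \<Longrightarrow> y \<le> 1 \<Longrightarrow> h y = (0::real)"
    and c: "\<And>n. norm (c (Suc n)) \<le> C * real (Suc n) powr \<mu>"
  shows "laplace_pair
     (\<lambda>x. \<Sum>n. c (Suc n) * complex_of_real (real (Suc n) powr \<sigma> * h (x / real (Suc n))))
     (\<lambda>s. \<Sum>n. c (Suc n) * complex_of_real (real (Suc n) powr (\<sigma> + 1) * H (real (Suc n) * s)))"
proof -
  obtain K m where K: "\<And>y. y \<ge> 0 \<Longrightarrow> norm (h y) \<le> K * (1 + y) ^ m"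
    using pair by (auto simp: laplace_pair_def)
  have K0: "K \<ge> 0" using order.trans[OF norm_ge_zero K[of 0]] by simp
  have C0: "C \<ge> 0" using order.trans[OF norm_ge_zero c[of 0]] by simp
  define L where "L = nat \<lceil>\<bar>\<mu> + \<sigma>\<bar>\<rceil> + 2"
  show ?thesis
  proof (rule laplace_pair_suminf[where c = "\<lambda>n. C * K * real (Suc n) powr (- 2)" and m = "L + m"])
    show "summable (\<lambda>n. C * K * real (Suc n) powr (- 2))"
      by (intro summable_mult summable_Suc_powr) auto
    fix n
    define N where "N = real (Suc n)"
    have N: "N \<ge> 1" by (simp add: N_def)
    have "laplace_pair (\<lambda>x. h (1 / N * x)) (\<lambda>s. H (s / (1 / N)) /\<^sub>R (1 / N))"
      by (rule laplace_pair_scale[OF pair]) (use N in auto)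
    hence "laplace_pair (\<lambda>x. h (x / N)) (\<lambda>s. N * H (N * s))"
      by (rule laplace_pair_cong) (use N in \<open>auto simp: mult_ac\<close>)
    from laplace_pair_mult[OF laplace_pair_of_real[OF laplace_pair_mult[OF this, of "N powr \<sigma>"]], of "c (Suc n)"]
    show "laplace_pair (\<lambda>x. c (Suc n) * complex_of_real (real (Suc n) powr \<sigma> * h (x / real (Suc n))))
      (\<lambda>s. c (Suc n) * complex_of_real (real (Suc n) powr (\<sigma> + 1) * H (real (Suc n) * s)))"
      unfolding N_def[symmetric] using N by (simp add: powr_add mult.assoc)
    fix x :: real assume x: "x \<ge> 0"
    show "norm (c (Suc n) * complex_of_real (real (Suc n) powr \<sigma> * h (x / real (Suc n)))) \<le>
            C * K * real (Suc n) powr (- 2) * (1 + x) ^ (L + m)"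
      unfolding N_def[symmetric]
    proof (cases "x \<le> N")
      case True
      hence "h (x / N) = 0" using N x by (intro zero) auto
      thus "norm (c (Suc n) * complex_of_real (N powr \<sigma> * h (x / N))) \<le> C * K * N powr (- 2) * (1 + x) ^ (L + m)"
        using K0 C0 x by simp
    next
      case False
      have "x / N \<le> x / 1" using N x by (intro divide_left_mono) auto
      hence "x / N \<le> x" by simp
      hence "norm (h (x / N)) \<le> K * (1 + x) ^ m"
        using K0 N x by (intro order.trans[OF K] mult_left_mono power_mono) auto
      hence "norm (c (Suc n) * complex_of_real (N powr \<sigma> * h (x / N))) \<le>
              (C * N powr \<mu>) * (N powr \<sigma> * (K * (1 + x) ^ m))"
        unfolding norm_mult norm_of_real abs_mult
        using c[of n] C0 K0 x by (intro mult_mono) (auto simp: N_def)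
      also have "\<dots> = C * K * (1 + x) ^ m * N powr (\<mu> + \<sigma>)"
        by (simp add: powr_add)
      also have "\<dots> \<le> C * K * (1 + x) ^ m * (N powr (- 2) * (1 + x) ^ L)"
      proof (rule mult_left_mono)
        have "N powr (\<mu> + \<sigma>) \<le> N powr (- 2 + real L)"
          using N by (intro powr_mono) (auto simp: L_def, linarith)
        also have "\<dots> = N powr (- 2) * N ^ L"
          using N by (simp only: powr_add) (simp add: powr_realpow)
        also have "\<dots> \<le> N powr (- 2) * (1 + x) ^ L"
          using False N by (intro mult_left_mono power_mono) auto
        finally show "N powr (\<mu> + \<sigma>) \<le> N powr (- 2) * (1 + x) ^ L" .
      qed (use K0 C0 x in auto)
      also have "\<dots> = C * K * N powr (- 2) * (1 + x) ^ (L + m)"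
        by (simp only: power_add mult_ac)
      finally show "norm (c (Suc n) * complex_of_real (N powr \<sigma> * h (x / N))) \<le> C * K * N powr (- 2) * (1 + x) ^ (L + m)" .
    qed
  qed
qed

text \<open>In contrast to \<open>laplace_pair_sum_below\<close>, all n contribute at every x, and
  convergence rests on \<mu> - \<beta> < - 1. The second conclusion retains the exact power of x,
  which becomes the error term.\<close>

lemma laplace_pair_sum_dual:
  fixes c :: "nat \<Rightarrow> complex"
  assumes pair: "\<And>n. laplace_pair (g n) (G n)"
    and bound: "\<And>n x. x \<ge> 0 \<Longrightarrow> \<bar>g n x\<bar> \<le> K * real (Suc n) powr (- \<beta>) * x powr \<alpha>"
    and "K \<ge> 0" "\<alpha> \<ge> 0" "\<mu> - \<beta> < - 1"
    and c: "\<And>n. norm (c (Suc n)) \<le> C * real (Suc n) powr \<mu>"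
  shows "laplace_pair (\<lambda>x. \<Sum>n. c (Suc n) * complex_of_real (g n x))
           (\<lambda>s. \<Sum>n. c (Suc n) * complex_of_real (G n s))"
    and "\<exists>K'. \<forall>x\<ge>0. norm (\<Sum>n. c (Suc n) * complex_of_real (g n x)) \<le> K' * x powr \<alpha>"
proof -
  have C0: "C \<ge> 0" using order.trans[OF norm_ge_zero c[of 0]] by simp
  define d where "d = (\<lambda>n. C * K * real (Suc n) powr (\<mu> - \<beta>))"
  have d: "summable d" unfolding d_def using assms by (intro summable_mult summable_Suc_powr) auto
  have d0: "d n \<ge> 0" for n using C0 assms by (simp add: d_def)
  have bd: "norm (c (Suc n) * complex_of_real (g n x)) \<le> d n * x powr \<alpha>" if "x \<ge> 0" for n x
  proof -
    have "norm (c (Suc n) * complex_of_real (g n x)) \<le>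
           (C * real (Suc n) powr \<mu>) * (K * real (Suc n) powr (- \<beta>) * x powr \<alpha>)"
      unfolding norm_mult norm_of_real
      using c[of n] bound[OF that, of n] C0 by (intro mult_mono) auto
    also have "\<dots> = C * K * (real (Suc n) powr \<mu> * real (Suc n) powr (- \<beta>)) * x powr \<alpha>"
      by (simp add: mult_ac)
    also have "real (Suc n) powr \<mu> * real (Suc n) powr (- \<beta>) = real (Suc n) powr (\<mu> - \<beta>)"
      by (simp only: powr_add[symmetric] add_uminus_conv_diff)
    finally show ?thesis by (simp only: d_def)
  qed
  define m where "m = nat \<lceil>\<alpha>\<rceil>"
  show "laplace_pair (\<lambda>x. \<Sum>n. c (Suc n) * complex_of_real (g n x))
           (\<lambda>s. \<Sum>n. c (Suc n) * complex_of_real (G n s))"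
  proof (rule laplace_pair_suminf[where m = m, OF _ d])
    fix n and x :: real assume x: "x \<ge> 0"
    have "x powr \<alpha> \<le> (1 + x) powr \<alpha>" using x assms by (intro powr_mono2) auto
    also have "\<dots> \<le> (1 + x) powr real m" using x by (intro powr_mono) (auto simp: m_def, linarith)
    also have "\<dots> = (1 + x) ^ m" using x by (simp add: powr_realpow)
    finally show "norm (c (Suc n) * complex_of_real (g n x)) \<le> d n * (1 + x) ^ m"
      using d0[of n] by (intro order.trans[OF bd[OF x]] mult_left_mono)
  qed (intro laplace_pair_mult laplace_pair_of_real pair)
  have "norm (\<Sum>n. c (Suc n) * complex_of_real (g n x)) \<le> (\<Sum>n. d n) * x powr \<alpha>" if "x \<ge> 0" for x
  proof -
    have "norm (\<Sum>n. c (Suc n) * complex_of_real (g n x)) \<le> (\<Sum>n. d n * x powr \<alpha>)"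
    proof (rule order.trans[OF summable_norm suminf_le])
      show "summable (\<lambda>n. norm (c (Suc n) * complex_of_real (g n x)))"
        by (rule summable_comparison_test'[OF summable_mult2[OF d, of "x powr \<alpha>"], of 0])
           (use bd[OF that] in simp)
      thus "summable (\<lambda>n. norm (c (Suc n) * complex_of_real (g n x)))" .
    qed (use bd[OF that] summable_mult2[OF d] in auto)
    thus ?thesis by (simp add: suminf_mult2[OF d])
  qed
  thus "\<exists>K'. \<forall>x\<ge>0. norm (\<Sum>n. c (Suc n) * complex_of_real (g n x)) \<le> K' * x powr \<alpha>" by blast
qed

text \<open>With v = s/(2 pi) one has q^n = exp (- ns) and 4 pi n v = 2ns. The two summability
  claims serve to multiply the series by a power of s term by term.\<close>

lemma Maass_expansion_imag_axis:
  assumes "has_Maass_expansion k f ap am" "s > 0"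
  shows "summable (\<lambda>n. ap (Suc n) * complex_of_real (exp (- (real (Suc n) * s))))"
    and "summable (\<lambda>n. am (Suc n) * complex_of_real (exp (real (Suc n) * s) * incomplete_Gamma (1 - k) (2 * (real (Suc n) * s))))"
    and "f (\<i> * complex_of_real (s / (2 * pi))) =
      ap 0 + (\<Sum>n. ap (Suc n) * complex_of_real (exp (- (real (Suc n) * s)))) +
      am 0 * complex_of_real ((s / (2 * pi)) powr (1 - k)) +
      (\<Sum>n. am (Suc n) * complex_of_real (exp (real (Suc n) * s) * incomplete_Gamma (1 - k) (2 * (real (Suc n) * s))))"
proof -
  define \<tau> where "\<tau> = \<i> * complex_of_real (s / (2 * pi))"
  have Im: "Im \<tau> = s / (2 * pi)" by (simp add: \<tau>_def)
  have "\<tau> \<in> upper_half_plane" using assms by (simp add: upper_half_plane_def Im)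
  have "2 * complex_of_real pi * \<i> * \<tau> = - complex_of_real s"
    by (simp add: \<tau>_def)
  hence nome: "nome \<tau> = complex_of_real (exp (- s))"
    by (simp add: nome_def exp_of_real flip: of_real_minus)
  have pow: "nome \<tau> ^ n = complex_of_real (exp (- (real n * s)))" for n
    by (simp add: nome exp_of_nat_mult[symmetric] flip: of_real_power)
  have powi: "nome \<tau> powi (- int n) = complex_of_real (exp (real n * s))" for n
    by (simp add: power_int_minus pow exp_minus)
  have arg: "4 * pi * real n * Im \<tau> = 2 * (real n * s)" for n
    by (simp add: Im)
  define hol where "hol = (\<lambda>n. ap n * complex_of_real (exp (- (real n * s))))"
  have nonhol: "am n * complex_of_real (incomplete_Gamma (1 - k) (4 * pi * real n * Im \<tau>)) * nome \<tau> powi (- int n)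
     = am n * complex_of_real (exp (real n * s) * incomplete_Gamma (1 - k) (2 * (real n * s)))" for n
    unfolding powi arg by simp
 from bspec[OF assms(1)[unfolded has_Maass_expansion_def Let_def] \<open>\<tau> \<in> upper_half_plane\<close>]
  have *: "summable hol \<and>
     summable (\<lambda>n. am (Suc n) * complex_of_real (exp (real (Suc n) * s) * incomplete_Gamma (1 - k) (2 * (real (Suc n) * s)))) \<and>
     f \<tau> = (\<Sum>n. hol n) + am 0 * complex_of_real (Im \<tau> powr (1 - k)) +
       (\<Sum>n. am (Suc n) * complex_of_real (exp (real (Suc n) * s) * incomplete_Gamma (1 - k) (2 * (real (Suc n) * s))))"
    unfolding nonhol pow hol_def .
  show "summable (\<lambda>n. ap (Suc n) * complex_of_real (exp (- (real (Suc n) * s))))"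
    using conjunct1[OF *] summable_Suc_iff[of hol] by (simp add: hol_def)
  show "summable (\<lambda>n. am (Suc n) * complex_of_real (exp (real (Suc n) * s) * incomplete_Gamma (1 - k) (2 * (real (Suc n) * s))))"
    using * by blast
  have "(\<Sum>n. hol n) = ap 0 + (\<Sum>n. ap (Suc n) * complex_of_real (exp (- (real (Suc n) * s))))"
    using suminf_split_head[of hol] * by (simp add: hol_def)
  with * show "f (\<i> * complex_of_real (s / (2 * pi))) =
      ap 0 + (\<Sum>n. ap (Suc n) * complex_of_real (exp (- (real (Suc n) * s)))) +
      am 0 * complex_of_real ((s / (2 * pi)) powr (1 - k)) +
      (\<Sum>n. am (Suc n) * complex_of_real (exp (real (Suc n) * s) * incomplete_Gamma (1 - k) (2 * (real (Suc n) * s))))"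
    by (simp only: \<tau>_def[symmetric] Im)
qed

lemma suminf_Suc_eq_sum_upto:
  fixes a :: "nat \<Rightarrow> complex"
  assumes "\<And>n. n > 0 \<Longrightarrow> \<phi> n = (if real n \<le> x then \<psi> n else 0)"
  shows "(\<Sum>n. a (Suc n) * \<phi> (Suc n)) = (\<Sum>n | 1 \<le> n \<and> real n \<le> x. a n * \<psi> n)"
proof -
  have "finite {n. real (Suc n) \<le> x}"
    by (rule finite_subset[of _ "{..nat \<lfloor>x\<rfloor>}"]) (auto simp: le_nat_floor)
  hence "(\<Sum>n. a (Suc n) * \<phi> (Suc n)) = (\<Sum>n | real (Suc n) \<le> x. a (Suc n) * \<phi> (Suc n))"
    by (rule suminf_finite) (use assms in auto)
  also have "\<dots> = (\<Sum>n | 1 \<le> n \<and> real n \<le> x. a n * \<psi> n)"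
    by (rule sum.reindex_bij_witness[of _ "\<lambda>n. n - 1" Suc]) (use assms in auto)
  finally show ?thesis .
qed

text \<open>The weight n^\<rho> does two things: n^\<rho> (x/n - 1)^\<rho> is the Riesz weight (x -
  n)^\<rho>, and on the transform side n^(\<rho> + 1) (ns)^(- \<rho> - 1) no longer depends on n, so
  a common factor s^(- \<rho> - 1) comes out of the expansion of f.\<close>

lemma laplace_pair_riesz_sum:
  fixes ap am :: "nat \<Rightarrow> complex"
  assumes exp: "has_Maass_expansion k f ap am"
    and ap: "\<And>n. norm (ap (Suc n)) \<le> Cp * real (Suc n) powr \<mu>p"
    and am: "\<And>n. norm (am (Suc n)) \<le> Cm * real (Suc n) powr \<mu>m"
    and \<rho>: "\<rho> > 0" "k + \<rho> > 1"
  shows "laplace_pair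
     (\<lambda>x. riesz_sum k \<rho> ap am x + ap 0 * complex_of_real (x powr \<rho> / Gamma (\<rho> + 1)) +
          am 0 * complex_of_real ((2 * pi) powr (k - 1) * (x powr (\<rho> + k - 1) / Gamma (\<rho> + k))))
     (\<lambda>s. complex_of_real (s powr (- \<rho> - 1)) * f (\<i> * complex_of_real (s / (2 * pi))))"
proof -
  \<comment> \<open>With this p, s^(- p - 1) s^(k - 1) = s^(- \<rho> - 1), so the nonholomorphic
    terms get the same factor as the holomorphic ones.\<close>
  define p where "p = k + \<rho> - 1"
  have p: "p > 0" using \<rho> by (simp add: p_def)
  have 1: "laplace_pair (\<lambda>y. max 0 (y - 1) powr \<rho> / Gamma (\<rho> + 1)) (\<lambda>s. exp (- (1 * s)) *\<^sub>R s powr (- \<rho> - 1))"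
    by (rule laplace_pair_shift[OF laplace_pair_powr[OF \<rho>(1)]]) auto
  note 2 = laplace_pair_sum_below[where \<sigma> = \<rho>, OF 1 _ ap]
  note 3 = laplace_pair_sum_below[where \<sigma> = \<rho>, OF laplace_pair_riesz_tail[OF p, of k] riesz_tail_eq_0 am]
  have 4: "laplace_pair (\<lambda>x. ap 0 * complex_of_real (x powr \<rho> / Gamma (\<rho> + 1)))
     (\<lambda>s. ap 0 * complex_of_real (s powr (- \<rho> - 1)))"
    by (intro laplace_pair_mult laplace_pair_of_real laplace_pair_powr \<rho>)
  have 5: "laplace_pair (\<lambda>x. am 0 * complex_of_real ((2 * pi) powr (k - 1) * (x powr p / Gamma (p + 1))))
     (\<lambda>s. am 0 * complex_of_real ((2 * pi) powr (k - 1) * s powr (- p - 1)))"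
    by (intro laplace_pair_mult laplace_pair_of_real laplace_pair_powr p)
  show ?thesis
  proof (rule laplace_pair_cong[OF laplace_pair_add[OF laplace_pair_add[OF laplace_pair_add[OF 2 3] 4] 5]])
    fix x :: real assume x: "x \<ge> 0"
    have a: "(\<Sum>n. ap (Suc n) * complex_of_real (real (Suc n) powr \<rho> * (max 0 (x / real (Suc n) - 1) powr \<rho> / Gamma (\<rho> + 1))))
       = (\<Sum>n | 1 \<le> n \<and> real n \<le> x. ap n * complex_of_real ((x - real n) powr \<rho> / Gamma (\<rho> + 1)))"
    proof (rule suminf_Suc_eq_sum_upto[where \<phi> = "\<lambda>n. complex_of_real (real n powr \<rho> * (max 0 (x / real n - 1) powr \<rho> / Gamma (\<rho> + 1)))"])
      fix n :: nat assume n: "n > 0"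
      show "complex_of_real (real n powr \<rho> * (max 0 (x / real n - 1) powr \<rho> / Gamma (\<rho> + 1))) =
         (if real n \<le> x then complex_of_real ((x - real n) powr \<rho> / Gamma (\<rho> + 1)) else 0)"
      proof (cases "real n \<le> x")
        case True
        have "real n powr \<rho> * (x / real n - 1) powr \<rho> = (real n * (x / real n - 1)) powr \<rho>"
          using n True by (intro powr_mult[symmetric])
        also have "real n * (x / real n - 1) = x - real n"
          using n by (simp add: right_diff_distrib)
        finally have "real n powr \<rho> * (x / real n - 1) powr \<rho> = (x - real n) powr \<rho>" .
        moreover have "max 0 (x / real n - 1) = x / real n - 1" using n True by (simp add: field_simps)
        ultimately show ?thesis using True by simp
      next
        case False
        hence "max 0 (x / real n - 1) = 0" using n by (simp add: field_simps)
        thus ?thesis using False by simp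
      qed
    qed
    have b: "(\<Sum>n. am (Suc n) * complex_of_real (real (Suc n) powr \<rho> * riesz_tail k p (x / real (Suc n))))
       = (\<Sum>n | 1 \<le> n \<and> real n \<le> x. am n * (complex_of_real (x powr \<rho>) / (2 * complex_of_real pi * \<i>) * g_kernel k \<rho> n x))"
      unfolding p_def
      by (rule suminf_Suc_eq_sum_upto[where \<phi> = "\<lambda>n. complex_of_real (real n powr \<rho> * riesz_tail k (k + \<rho> - 1) (x / real n))"])
         (rule riesz_tail_g_kernel[OF \<rho>(2) _ x])
    have e: "\<rho> + k - 1 = p" "\<rho> + k = p + 1" by (simp_all add: p_def)
    show "(\<Sum>n. ap (Suc n) * complex_of_real (real (Suc n) powr \<rho> * (max 0 (x / real (Suc n) - 1) powr \<rho> / Gamma (\<rho> + 1)))) +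
        (\<Sum>n. am (Suc n) * complex_of_real (real (Suc n) powr \<rho> * riesz_tail k p (x / real (Suc n)))) +
        ap 0 * complex_of_real (x powr \<rho> / Gamma (\<rho> + 1)) +
        am 0 * complex_of_real ((2 * pi) powr (k - 1) * (x powr p / Gamma (p + 1))) =
       riesz_sum k \<rho> ap am x + ap 0 * complex_of_real (x powr \<rho> / Gamma (\<rho> + 1)) +
        am 0 * complex_of_real ((2 * pi) powr (k - 1) * (x powr (\<rho> + k - 1) / Gamma (\<rho> + k)))"
      unfolding a b e riesz_sum_def by (simp add: sum_distrib_left mult_ac)
  next
    fix s :: real assume s: "s > 0"
    define q where "q = s powr (- \<rho> - 1)"
    define F where "F n = exp (- (real (Suc n) * s))" for n
    define J where "J n = exp (real (Suc n) * s) * incomplete_Gamma (1 - k) (2 * (real (Suc n) * s))" for n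
    note expansion = Maass_expansion_imag_axis[OF exp s, folded F_def J_def]
    have cancel: "real (Suc n) powr (\<rho> + 1) * (real (Suc n) * s) powr (- \<rho> - 1) = q" for n
    proof -
      have "real (Suc n) powr (\<rho> + 1) * (real (Suc n) * s) powr (- \<rho> - 1) =
          (real (Suc n) powr (\<rho> + 1) * real (Suc n) powr (- \<rho> - 1)) * q"
        using s by (simp add: powr_mult q_def mult.assoc del: of_nat_Suc)
      also have "real (Suc n) powr (\<rho> + 1) * real (Suc n) powr (- \<rho> - 1) = 1"
        by (simp add: powr_add[symmetric] del: of_nat_Suc)
      finally show ?thesis by simp
    qed
    have t1: "real (Suc n) powr (\<rho> + 1) * (exp (- (1 * (real (Suc n) * s))) *\<^sub>R (real (Suc n) * s) powr (- \<rho> - 1)) = F n * q" for n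
      using arg_cong[OF cancel[of n], of "\<lambda>z. F n * z"] by (simp add: F_def mult_ac del: of_nat_Suc)
    have t2: "real (Suc n) powr (\<rho> + 1) * ((real (Suc n) * s) powr (- p - 1) *
          ((real (Suc n) * s) powr (k - 1) * exp (real (Suc n) * s) * incomplete_Gamma (1 - k) (2 * (real (Suc n) * s)))) = J n * q" for n
    proof -
      have "(real (Suc n) * s) powr (- p - 1) * (real (Suc n) * s) powr (k - 1) = (real (Suc n) * s) powr (- \<rho> - 1)"
        by (simp add: p_def powr_add[symmetric] del: of_nat_Suc)
      hence "real (Suc n) powr (\<rho> + 1) * ((real (Suc n) * s) powr (- p - 1) * (real (Suc n) * s) powr (k - 1)) = q"
        by (simp only: cancel)
      from arg_cong[OF this, of "\<lambda>z. z * J n"] show ?thesis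
        by (simp only: J_def mult_ac)
    qed
    have t3: "(2 * pi) powr (k - 1) * s powr (- p - 1) = (s / (2 * pi)) powr (1 - k) * q"
    proof -
      have "s powr (- p - 1) = s powr (1 - k) * q"
        by (simp add: p_def q_def powr_add[symmetric])
      thus ?thesis using s by (simp add: powr_divide powr_diff)
    qed
    show "(\<Sum>n. ap (Suc n) * complex_of_real (real (Suc n) powr (\<rho> + 1) *
            (exp (- (1 * (real (Suc n) * s))) *\<^sub>R (real (Suc n) * s) powr (- \<rho> - 1)))) +
        (\<Sum>n. am (Suc n) * complex_of_real (real (Suc n) powr (\<rho> + 1) * ((real (Suc n) * s) powr (- p - 1) *
          ((real (Suc n) * s) powr (k - 1) * exp (real (Suc n) * s) * incomplete_Gamma (1 - k) (2 * (real (Suc n) * s)))))) +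
        ap 0 * complex_of_real (s powr (- \<rho> - 1)) +
        am 0 * complex_of_real ((2 * pi) powr (k - 1) * s powr (- p - 1)) =
        complex_of_real (s powr (- \<rho> - 1)) * f (\<i> * complex_of_real (s / (2 * pi)))"
      unfolding t1 t2 t3 q_def[symmetric] expansion(3) of_real_mult[of _ q]
      unfolding mult.assoc[symmetric]
        suminf_mult2[OF expansion(1), symmetric] suminf_mult2[OF expansion(2), symmetric]
      by (simp only: distrib_left mult_ac add_ac)
  qed (use \<rho> in auto)
qed

text \<open>The lower bounds on \<rho> + k and k + \<rho>/2 admit the individual kernels. The
  hypotheses on \<open>\<mu>p\<close> and \<open>\<mu>m\<close> say that n^(\<open>\<mu>p\<close> -
  (\<rho> + k)/2 - 1/4) and n^(\<open>\<mu>m\<close> - \<rho>/2 - k + 1/4) are summable. The bound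
  on \<open>D\<close> keeps both powers of x, because k decides which one is larger.\<close>

lemma laplace_pair_dual:
  fixes bp bm :: "nat \<Rightarrow> complex"
  assumes exp: "has_Maass_expansion k g bp bm"
    and bp: "\<And>n. norm (bp (Suc n)) \<le> Cp * real (Suc n) powr \<mu>p"
    and bm: "\<And>n. norm (bm (Suc n)) \<le> Cm * real (Suc n) powr \<mu>m"
    and \<rho>: "\<rho> > 0" "\<rho> + k > 1 / 2" "k + \<rho> / 2 > 1 / 4"
    and \<mu>: "2 * \<mu>p + 3 / 2 < \<rho> + k" "2 * \<mu>m + 5 / 2 < \<rho> + 2 * k"
    and b: "b > 0"
  obtains D K1 K2 where
    "laplace_pair
      (\<lambda>x. bp 0 * complex_of_real (x powr (\<rho> + k) / Gamma (\<rho> + k + 1)) +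
           bm 0 * complex_of_real ((b / (2 * pi)) powr (1 - k) * (x powr (\<rho> + 1) / Gamma (\<rho> + 2))) + D x)
      (\<lambda>s. complex_of_real (s powr (- \<rho> - k - 1)) * g (\<i> * complex_of_real (b / s / (2 * pi))))"
    "\<And>x. x \<ge> 0 \<Longrightarrow> norm (D x) \<le> K1 * x powr (\<rho> / 2 + (2 * k - 1) / 4) + K2 * x powr (\<rho> / 2 + 1 / 4)"
proof -
  define \<nu> where "\<nu> = \<rho> + k"
  have \<nu>: "\<nu> > 1 / 2" using \<rho> by (simp add: \<nu>_def)
  define B where "B = (\<lambda>n. b * real (Suc n))"
  have B: "B n > 0" for n using b by (simp add: B_def)
  obtain C1 where C1: "C1 \<ge> 0" "\<And>x. x \<ge> 0 \<Longrightarrow> \<bar>bessel_riesz \<nu> x\<bar> \<le> C1 * x powr (\<nu> / 2 - 1 / 4)"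
    using bessel_riesz_bound[of \<nu>] \<nu> by auto
  obtain C2 where C2: "C2 \<ge> 0" "\<And>y. y \<ge> 0 \<Longrightarrow> \<bar>bessel_tail k \<rho> y\<bar> \<le> C2 * y powr (\<rho> / 2 + 1 / 4)"
    using bessel_tail_bound[OF \<rho>(1,3)] by blast
  \<comment> \<open>Since the kernel bounds are pure powers for all arguments, scaling by
    \<open>B n\<close> splits off an exact power of n.\<close>
  have scaled_bound: "\<bar>B n powr (- e) * h (B n * x)\<bar> \<le> C * b powr (\<alpha> - e) * real (Suc n) powr (- (e - \<alpha>)) * x powr \<alpha>"
    if "\<And>x. x \<ge> 0 \<Longrightarrow> \<bar>h x\<bar> \<le> C * x powr \<alpha>" "x \<ge> 0" for h :: "real \<Rightarrow> real" and e \<alpha> C n x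
  proof -
    have "\<bar>B n powr (- e) * h (B n * x)\<bar> \<le> B n powr (- e) * (C * (B n * x) powr \<alpha>)"
      using that(1)[of "B n * x"] that(2) B[of n] by (auto simp: abs_mult intro!: mult_left_mono)
    also have "\<dots> = C * (B n powr (- e) * B n powr \<alpha>) * x powr \<alpha>"
      using that(2) B[of n] by (simp add: powr_mult)
    also have "B n powr (- e) * B n powr \<alpha> = B n powr (\<alpha> - e)"
      by (simp add: powr_add[symmetric])
    also have "\<dots> = b powr (\<alpha> - e) * real (Suc n) powr (- (e - \<alpha>))"
      unfolding B_def using b by (simp add: powr_mult)
    finally show ?thesis by (simp add: mult_ac)
  qed
  have P0: "laplace_pair (\<lambda>x. B n powr (- \<nu>) * bessel_riesz \<nu> (B n * x))
      (\<lambda>s. exp (- (B n / s)) * s powr (- \<nu> - 1))" for n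
    by (rule laplace_pair_bessel_riesz_scaled[OF \<nu> B])
  have M0: "laplace_pair (\<lambda>x. B n powr (- (\<rho> + k)) * bessel_tail k \<rho> (B n * x))
      (\<lambda>s. s powr (- \<nu> - 1) * (exp (B n / s) * incomplete_Gamma (1 - k) (2 * B n / s)))" for n
    using laplace_pair_bessel_tail_scaled[OF \<rho>(1,3) B, of n] by (simp add: \<nu>_def)
  define Dp where "Dp x = (\<Sum>n. bp (Suc n) * complex_of_real (B n powr (- \<nu>) * bessel_riesz \<nu> (B n * x)))" for x
  define Dm where "Dm x = (\<Sum>n. bm (Suc n) * complex_of_real (B n powr (- (\<rho> + k)) * bessel_tail k \<rho> (B n * x)))" for x
  have condp1: "C1 * b powr (\<nu> / 2 - 1 / 4 - \<nu>) \<ge> 0" using C1(1) by simp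
  have condp2: "\<nu> / 2 - 1 / 4 \<ge> 0" using \<nu> by simp
  have "\<mu>p - (\<nu> - (\<nu> / 2 - 1 / 4)) = \<mu>p - \<nu> / 2 - 1 / 4" by (simp add: field_simps)
  with \<mu>(1) have condp3: "\<mu>p - (\<nu> - (\<nu> / 2 - 1 / 4)) < - 1" unfolding \<nu>_def by linarith
  have condm1: "C2 * b powr (\<rho> / 2 + 1 / 4 - (\<rho> + k)) \<ge> 0" using C2(1) by simp
  have condm2: "\<rho> / 2 + 1 / 4 \<ge> 0" using \<rho> by simp
  have "\<mu>m - (\<rho> + k - (\<rho> / 2 + 1 / 4)) = \<mu>m - \<rho> / 2 - k + 1 / 4" by (simp add: field_simps)
  with \<mu>(2) have condm3: "\<mu>m - (\<rho> + k - (\<rho> / 2 + 1 / 4)) < - 1" by linarith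
  note P = laplace_pair_sum_dual[OF P0 scaled_bound[OF C1(2)] condp1 condp2 condp3 bp, folded Dp_def]
  note M = laplace_pair_sum_dual[OF M0 scaled_bound[OF C2(2)] condm1 condm2 condm3 bm, folded Dm_def]
  from P(2) obtain K1 where K1: "\<forall>x\<ge>0. norm (Dp x) \<le> K1 * x powr (\<nu> / 2 - 1 / 4)" ..
  from M(2) obtain K2 where K2: "\<forall>x\<ge>0. norm (Dm x) \<le> K2 * x powr (\<rho> / 2 + 1 / 4)" ..
  have Z1: "laplace_pair (\<lambda>x. bp 0 * complex_of_real (x powr \<nu> / Gamma (\<nu> + 1)))
     (\<lambda>s. bp 0 * complex_of_real (s powr (- \<nu> - 1)))"
    using \<nu> by (intro laplace_pair_mult laplace_pair_of_real laplace_pair_powr) auto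
  have Z2: "laplace_pair (\<lambda>x. bm 0 * complex_of_real ((b / (2 * pi)) powr (1 - k) * (x powr (\<rho> + 1) / Gamma (\<rho> + 1 + 1))))
     (\<lambda>s. bm 0 * complex_of_real ((b / (2 * pi)) powr (1 - k) * s powr (- (\<rho> + 1) - 1)))"
    using \<rho> by (intro laplace_pair_mult laplace_pair_of_real laplace_pair_powr) auto
  show ?thesis
  proof (rule that[of "\<lambda>x. Dp x + Dm x" K1 K2])
    show "laplace_pair
      (\<lambda>x. bp 0 * complex_of_real (x powr (\<rho> + k) / Gamma (\<rho> + k + 1)) +
           bm 0 * complex_of_real ((b / (2 * pi)) powr (1 - k) * (x powr (\<rho> + 1) / Gamma (\<rho> + 2))) + (Dp x + Dm x))
      (\<lambda>s. complex_of_real (s powr (- \<rho> - k - 1)) * g (\<i> * complex_of_real (b / s / (2 * pi))))"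
    proof (rule laplace_pair_cong[OF laplace_pair_add[OF laplace_pair_add[OF Z1 Z2] laplace_pair_add[OF P(1) M(1)]]])
      fix s :: real assume s: "s > 0"
      define q where "q = s powr (- \<nu> - 1)"
      have bs: "b / s > 0" using b s by simp
      define F where "F n = exp (- (real (Suc n) * (b / s)))" for n
      define J where "J n = exp (real (Suc n) * (b / s)) * incomplete_Gamma (1 - k) (2 * (real (Suc n) * (b / s)))" for n
      note expansion = Maass_expansion_imag_axis[OF exp bs, folded F_def J_def]
      have t1: "exp (- (B n / s)) * q = F n * q" for n
        by (simp add: F_def B_def mult_ac)
      have t2: "q * (exp (B n / s) * incomplete_Gamma (1 - k) (2 * B n / s)) = J n * q" for n
        by (simp add: J_def B_def mult_ac)
      \<comment> \<open>The factor v^(1 - k) at v = b/(2 pi s) turns s^(- \<rho> - k - 1) into s^(-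
        \<rho> - 2), which is why b^-(0) comes with x^(\<rho> + 1) for every k.\<close>
      have t3: "(b / (2 * pi)) powr (1 - k) * s powr (- (\<rho> + 1) - 1) = (b / s / (2 * pi)) powr (1 - k) * q"
      proof -
        have "s powr (- (\<rho> + 1) - 1) = s powr (k - 1) * q"
          by (simp add: \<nu>_def q_def powr_add[symmetric])
        moreover have "(b / (2 * pi) / s) powr (1 - k) = (b / (2 * pi)) powr (1 - k) / s powr (1 - k)"
          by (rule powr_divide)
        moreover have "s powr (k - 1) = 1 / s powr (1 - k)"
          using powr_minus_divide[of s "1 - k"] by simp
        moreover have "b / s / (2 * pi) = b / (2 * pi) / s" by simp
        ultimately show ?thesis by (simp add: mult.commute mult.left_commute)
      qed
      have q: "complex_of_real (s powr (- \<rho> - k - 1)) = complex_of_real q" by (simp add: q_def \<nu>_def)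
      show "bp 0 * complex_of_real (s powr (- \<nu> - 1)) +
         bm 0 * complex_of_real ((b / (2 * pi)) powr (1 - k) * s powr (- (\<rho> + 1) - 1)) +
         ((\<Sum>n. bp (Suc n) * complex_of_real (exp (- (B n / s)) * s powr (- \<nu> - 1))) +
          (\<Sum>n. bm (Suc n) * complex_of_real (s powr (- \<nu> - 1) * (exp (B n / s) * incomplete_Gamma (1 - k) (2 * B n / s))))) =
         complex_of_real (s powr (- \<rho> - k - 1)) * g (\<i> * complex_of_real (b / s / (2 * pi)))"
        unfolding q q_def[symmetric] t1 t2 t3 expansion(3) of_real_mult[of _ q]
      unfolding mult.assoc[symmetric]
          suminf_mult2[OF expansion(1), symmetric] suminf_mult2[OF expansion(2), symmetric]
        by (simp only: distrib_left mult_ac add_ac)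
    qed (simp_all add: \<nu>_def add.commute)
    fix x :: real assume x: "x \<ge> 0"
    have "\<nu> / 2 - 1 / 4 = \<rho> / 2 + (2 * k - 1) / 4" by (simp add: \<nu>_def field_simps)
    thus "norm (Dp x + Dm x) \<le> K1 * x powr (\<rho> / 2 + (2 * k - 1) / 4) + K2 * x powr (\<rho> / 2 + 1 / 4)"
      using K1[rule_format, OF x] K2[rule_format, OF x] by (intro norm_triangle_le add_mono) (simp_all only:)
  qed
qed

section \<open>The Fricke relation on the imaginary axis and the comparison of both sides\<close>

text \<open>The involution maps the axis to itself, and N\<tau> is a positive real times i there.
  Its logarithm therefore splits without a branch correction, and the principal power gives i^(- k)
  times a real power.\<close>

lemma fricke_imag_axis:
  assumes "N > 0" "s > 0"
  shows "fricke N k f (\<i> * complex_of_real (4 * pi\<^sup>2 / real N / s / (2 * pi))) =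
     complex_of_real (real N powr (k / 2) * (2 * pi / s) powr (- k)) * \<i> powr complex_of_real (- k) *
     f (\<i> * complex_of_real (s / (2 * pi)))"
proof -
  define \<tau> where "\<tau> = \<i> * complex_of_real (4 * pi\<^sup>2 / real N / s / (2 * pi))"
  have N\<tau>: "of_nat N * \<tau> = complex_of_real (2 * pi / s) * \<i>"
    using assms by (simp add: \<tau>_def power2_eq_square)
  have pos: "2 * pi / s > 0" using assms by simp
  have "(complex_of_real (2 * pi / s) * \<i>) powr complex_of_real (- k) =
          complex_of_real ((2 * pi / s) powr (- k)) * \<i> powr complex_of_real (- k)"
  proof -
    define r where "r = 2 * pi / s"
    have r: "r > 0" using pos by (simp add: r_def)
    have "(complex_of_real r * \<i>) powr complex_of_real (- k) =
            exp (complex_of_real (- k) * (Ln \<i> + complex_of_real (ln r)))"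
      using r by (simp add: powr_def Ln_times_of_real Ln_of_real add.commute)
    also have "\<dots> = \<i> powr complex_of_real (- k) * exp (complex_of_real (- k * ln r))"
      by (simp only: distrib_left exp_add of_real_mult) (simp add: powr_def)
    also have "exp (complex_of_real (- k * ln r)) = complex_of_real (r powr (- k))"
      using r unfolding exp_of_real by (simp add: powr_def)
    finally show ?thesis by (simp only: r_def mult.commute)
  qed
  moreover have "- 1 / (of_nat N * \<tau>) = \<i> * complex_of_real (s / (2 * pi))"
    unfolding N\<tau> using assms by (simp add: field_simps)
  ultimately show ?thesis
    unfolding fricke_def \<tau>_def[symmetric] N\<tau> by simp
qed

lemma bigo_powr_mono:
  assumes "p \<le> (q :: real)"
  shows "(\<lambda>x. c * complex_of_real (x powr p)) \<in> O[at_top](\<lambda>x. complex_of_real (x powr q))"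
proof (rule landau_o.bigI[of "norm c + 1"])
  show "eventually (\<lambda>x. norm (c * complex_of_real (x powr p)) \<le> (norm c + 1) * norm (complex_of_real (x powr q))) at_top"
    using eventually_ge_at_top[of 1]
    by eventually_elim (use assms in \<open>auto simp: norm_mult intro!: mult_mono powr_mono\<close>)
qed (simp add: add_nonneg_pos)

theorem theorem4p3:
  fixes k \<rho> \<mu>fp \<mu>fm \<mu>gp \<mu>gm :: real
    and N :: nat
    and \<psi> :: "int ^ 2 ^ 2 \<Rightarrow> complex"
    and f g :: "complex \<Rightarrow> complex"
    and ap am bp bm :: "nat \<Rightarrow> complex"
  assumes "k \<in> \<int> \<or> k - 1 / 2 \<in> \<int>"
    and "N > 0"
    and "k - 1 / 2 \<in> \<int> \<Longrightarrow> 4 dvd N"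
    and "Gamma0_character N \<psi>"
    and "f \<in> H_Eis k N \<psi>"
    and "\<And>\<tau>. \<tau> \<in> upper_half_plane \<Longrightarrow> g \<tau> = fricke N k f \<tau>"
    and "has_Maass_expansion k f ap am"
    and "has_Maass_expansion k g bp bm"
    and "\<mu>fp > 0" and "\<mu>fm > 0" and "\<mu>gp > 0" and "\<mu>gm > 0"
    and "ap \<in> O(\<lambda>n. complex_of_real (real n powr \<mu>fp))"
    and "am \<in> O(\<lambda>n. complex_of_real (real n powr \<mu>fm))"
    and "bp \<in> O(\<lambda>n. complex_of_real (real n powr \<mu>gp))"
    and "bm \<in> O(\<lambda>n. complex_of_real (real n powr \<mu>gm))"
    and "\<rho> > rho_zero k \<mu>fp \<mu>fm \<mu>gp \<mu>gm - 1 / 2"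
  shows "(\<lambda>x. riesz_sum k \<rho> ap am x - Q_main k N \<rho> (ap 0) (am 0) (bp 0) (bm 0) x)
           \<in> O[at_top](\<lambda>x. complex_of_real (x powr (\<rho> / 2 + max (1 / 4) ((2 * k - 1) / 4))))
    \<and> (1 < k \<and> k \<le> 2 \<longrightarrow>
        (\<lambda>x. riesz_sum k \<rho> ap am x
               - bp 0 * \<i> powr complex_of_real k * complex_of_real ((2 * pi) powr k)
                   / complex_of_real (real N powr (k / 2) * Gamma (\<rho> + k + 1))
                   * complex_of_real (x powr (\<rho> + k)))
           \<in> O[at_top](\<lambda>x. complex_of_real (x powr (\<rho> + 1))))
    \<and> (k = 1 \<longrightarrow>
        (\<lambda>x. riesz_sum k \<rho> ap am x
               - 2 * complex_of_real pi * \<i> / complex_of_real (sqrt (real N) * Gamma (\<rho> + 2))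
                   * (bm 0 + bp 0) * complex_of_real (x powr (\<rho> + 1)))
           \<in> O[at_top](\<lambda>x. complex_of_real (x powr \<rho>)))
    \<and> (k < 1 \<longrightarrow>
        (\<lambda>x. riesz_sum k \<rho> ap am x
               - complex_of_real (2 * pi * real N powr (k / 2 - 1)) * bm 0 * \<i> powr complex_of_real k
                   / complex_of_real (Gamma (\<rho> + 2))
                   * complex_of_real (x powr (\<rho> + 1)))
           \<in> O[at_top](\<lambda>x. complex_of_real (x powr max \<rho> (\<rho> + k))))"
proof -
  define b where "b = 4 * pi\<^sup>2 / real N"
  have b: "b > 0" using \<open>N > 0\<close> by (simp add: b_def)
  have b2: "b / (2 * pi) = 2 * pi / real N" by (simp add: b_def power2_eq_square)
  define r0 where "r0 = rho_zero k \<mu>fp \<mu>fm \<mu>gp \<mu>gm"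
  have r0_ge: "2 + 2 * \<mu>gp - k \<le> r0" "2 + 2 * \<mu>gm - k \<le> r0" "k \<le> r0" if "k \<ge> 1"
    using that by (simp_all add: r0_def rho_zero_def)
  have r0_ge': "3 + 2 * \<mu>gp - 2 * k \<le> r0" "3 + 2 * \<mu>gm - 2 * k \<le> r0" if "k < 1"
    using that by (simp_all add: r0_def rho_zero_def)
  have \<rho>: "\<rho> > r0 - 1 / 2" using assms(17) by (simp add: r0_def)
  \<comment> \<open>For k \<ge> 1 the entry k of \<rho>_0 gives \<rho> > 1/2, and the holomorphic
    inequality plus k \<ge> 1 gives the shape of the nonholomorphic one. For k < 1 the entries are
    adapted to the nonholomorphic inequality, and - k > - 1 yields the other.\<close>
  have cond: "\<rho> > 1 / 2" "2 * \<mu>gp + 3 / 2 < \<rho> + k" "2 * \<mu>gm + 5 / 2 < \<rho> + 2 * k"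
    using \<rho> r0_ge r0_ge' \<open>\<mu>gp > 0\<close> by (cases "k \<ge> 1"; force)+
  have cond': "k + \<rho> > 1" "\<rho> > 0" "\<rho> + k > 1 / 2" "k + \<rho> / 2 > 1 / 4"
    using cond \<open>\<mu>gp > 0\<close> \<open>\<mu>gm > 0\<close> by auto

  obtain Cfp where fp: "\<And>n. norm (ap (Suc n)) \<le> Cfp * real (Suc n) powr \<mu>fp"
    using coeff_bound_of_bigo[OF assms(13)] \<open>\<mu>fp > 0\<close> by (metis less_imp_le)
  obtain Cfm where fm: "\<And>n. norm (am (Suc n)) \<le> Cfm * real (Suc n) powr \<mu>fm"
    using coeff_bound_of_bigo[OF assms(14)] \<open>\<mu>fm > 0\<close> by (metis less_imp_le)
  obtain Cgp where gp: "\<And>n. norm (bp (Suc n)) \<le> Cgp * real (Suc n) powr \<mu>gp"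
    using coeff_bound_of_bigo[OF assms(15)] \<open>\<mu>gp > 0\<close> by (metis less_imp_le)
  obtain Cgm where gm: "\<And>n. norm (bm (Suc n)) \<le> Cgm * real (Suc n) powr \<mu>gm"
    using coeff_bound_of_bigo[OF assms(16)] \<open>\<mu>gm > 0\<close> by (metis less_imp_le)

  define I where "I = \<i> powr complex_of_real k"
  have I: "I * \<i> powr complex_of_real (- k) = 1"
    by (simp add: I_def powr_minus)
  define \<kappa> where "\<kappa> = I * complex_of_real (real N powr (- k / 2) * (2 * pi) powr k)"
  note riesz = laplace_pair_riesz_sum[OF assms(7) fp fm cond'(2,1)]
  obtain D K1 K2 where D: "laplace_pair
      (\<lambda>x. bp 0 * complex_of_real (x powr (\<rho> + k) / Gamma (\<rho> + k + 1)) +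
           bm 0 * complex_of_real ((b / (2 * pi)) powr (1 - k) * (x powr (\<rho> + 1) / Gamma (\<rho> + 2))) + D x)
      (\<lambda>s. complex_of_real (s powr (- \<rho> - k - 1)) * g (\<i> * complex_of_real (b / s / (2 * pi))))"
    and D_bound: "\<And>x. x \<ge> 0 \<Longrightarrow> norm (D x) \<le> K1 * x powr (\<rho> / 2 + (2 * k - 1) / 4) + K2 * x powr (\<rho> / 2 + 1 / 4)"
    by (rule laplace_pair_dual[OF assms(8) gp gm cond'(2,3,4) cond(2,3) b]) blast
  have dual: "laplace_pair
      (\<lambda>x. \<kappa> * (bp 0 * complex_of_real (x powr (\<rho> + k) / Gamma (\<rho> + k + 1)) +
           bm 0 * complex_of_real ((b / (2 * pi)) powr (1 - k) * (x powr (\<rho> + 1) / Gamma (\<rho> + 2))) + D x))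
      (\<lambda>s. complex_of_real (s powr (- \<rho> - 1)) * f (\<i> * complex_of_real (s / (2 * pi))))"
  proof (rule laplace_pair_cong[OF laplace_pair_mult[OF D]])
    fix s :: real assume s: "s > 0"
    have "\<i> * complex_of_real (b / s / (2 * pi)) \<in> upper_half_plane"
      using b s by (simp add: upper_half_plane_def)
    hence g: "g (\<i> * complex_of_real (b / s / (2 * pi))) =
        complex_of_real (real N powr (k / 2) * (2 * pi / s) powr (- k)) * \<i> powr complex_of_real (- k) *
         f (\<i> * complex_of_real (s / (2 * pi)))"
      using assms(6) fricke_imag_axis[OF \<open>N > 0\<close> s] by (simp only: b_def)
    have "real N powr (- k / 2) * (2 * pi) powr k * s powr (- \<rho> - k - 1) *
           (real N powr (k / 2) * (2 * pi / s) powr (- k)) =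
          (real N powr (- k / 2) * real N powr (k / 2)) * ((2 * pi) powr k * (2 * pi) powr (- k)) *
          (s powr (- \<rho> - k - 1) * s powr k)"
      using s by (simp add: powr_divide powr_minus field_simps)
    also have "\<dots> = s powr (- \<rho> - 1)"
      using \<open>N > 0\<close> by (simp add: powr_add[symmetric])
    finally have "complex_of_real (s powr (- \<rho> - 1)) = complex_of_real (real N powr (- k / 2) * (2 * pi) powr k) *
           complex_of_real (s powr (- \<rho> - k - 1)) *
           complex_of_real (real N powr (k / 2) * (2 * pi / s) powr (- k)) * (I * \<i> powr complex_of_real (- k))"
      unfolding I by (simp only: of_real_mult[symmetric] mult_1_right)
    thus "\<kappa> * (complex_of_real (s powr (- \<rho> - k - 1)) * g (\<i> * complex_of_real (b / s / (2 * pi)))) =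
        complex_of_real (s powr (- \<rho> - 1)) * f (\<i> * complex_of_real (s / (2 * pi)))"
      unfolding g \<kappa>_def by (simp only: mult_ac)
  qed auto

  define e where "e = \<rho> / 2 + max (1 / 4) ((2 * k - 1) / 4)"
  define Q where "Q = Q_main k N \<rho> (ap 0) (am 0) (bp 0) (bm 0)"
  \<comment> \<open>Q_\<rho> is a combination of the pure powers \<rho>, \<rho> + 1, \<rho> + k - 1
    and \<rho> + k, so that each asymptotic case becomes a comparison of exponents.\<close>
  define c0 where "c0 = - ap 0 / complex_of_real (Gamma (\<rho> + 1))"
  define c1 where "c1 = complex_of_real (2 * pi * real N powr (k / 2 - 1)) * bm 0 * I / complex_of_real (Gamma (\<rho> + 2))"
  define c2 where "c2 = - am 0 * complex_of_real ((2 * pi) powr (k - 1)) / complex_of_real (Gamma (\<rho> + k))"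
  define c3 where "c3 = bp 0 * I * complex_of_real ((2 * pi) powr k) / complex_of_real (real N powr (k / 2) * Gamma (\<rho> + k + 1))"
  define q :: "complex \<Rightarrow> real \<Rightarrow> real \<Rightarrow> complex" where "q c p x = c * complex_of_real (x powr p)" for c p x
  have Q_eq: "Q x = q c0 \<rho> x + q c1 (\<rho> + 1) x + q c2 (\<rho> + k - 1) x + q c3 (\<rho> + k) x" if "x > 0" for x
  proof -
    have "x powr (\<rho> + 1) = x powr \<rho> * x" "x powr (\<rho> + k - 1) = x powr \<rho> * x powr (k - 1)"
      "x powr (\<rho> + k) = x powr \<rho> * x powr k"
      using that by (simp_all add: powr_add powr_diff)
    thus ?thesis
      unfolding Q_def Q_main_def q_def c0_def c1_def c2_def c3_def I_def[symmetric]
      by (simp add: algebra_simps)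
  qed
  have S_eq: "riesz_sum k \<rho> ap am x = Q x + \<kappa> * D x" if "x > 0" for x
  proof -
    \<comment> \<open>The powers of 2 pi collapse to 2 pi, and N^(- k/2) N^(k - 1) = N^(k/2 - 1):
      this is the coefficient of b^-(0) in Q_\<rho>.\<close>
    have \<kappa>: "\<kappa> * complex_of_real ((b / (2 * pi)) powr (1 - k)) = I * complex_of_real (2 * pi * real N powr (k / 2 - 1))"
    proof -
      have "real N powr (- k / 2) * (2 * pi) powr k * (2 * pi / real N) powr (1 - k) =
         ((2 * pi) powr k * (2 * pi) powr (1 - k)) * (real N powr (- k / 2) * real N powr (k - 1))"
        using \<open>N > 0\<close> by (simp add: powr_divide powr_diff field_simps)
      also have "\<dots> = 2 * pi * real N powr (k / 2 - 1)"
        by (simp add: powr_add[symmetric])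
      finally show ?thesis
        unfolding \<kappa>_def b2 by (simp only: of_real_mult[symmetric] mult.assoc)
    qed
    have \<kappa>': "\<kappa> = I * complex_of_real ((2 * pi) powr k) / complex_of_real (real N powr (k / 2))"
      by (simp add: \<kappa>_def powr_minus field_simps)
    from laplace_pair_unique[OF riesz dual, of x] that
    have "riesz_sum k \<rho> ap am x = - ap 0 * complex_of_real (x powr \<rho> / Gamma (\<rho> + 1)) -
          am 0 * complex_of_real ((2 * pi) powr (k - 1) * (x powr (\<rho> + k - 1) / Gamma (\<rho> + k))) +
          (\<kappa> * bp 0 * complex_of_real (x powr (\<rho> + k) / Gamma (\<rho> + k + 1)) +
           (\<kappa> * complex_of_real ((b / (2 * pi)) powr (1 - k))) * bm 0 * complex_of_real (x powr (\<rho> + 1) / Gamma (\<rho> + 2)) + \<kappa> * D x)"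
      by (simp add: algebra_simps eq_diff_eq)
    also have "\<dots> = Q x + \<kappa> * D x"
      unfolding \<kappa> Q_eq[OF that] unfolding \<kappa>' q_def c0_def c1_def c2_def c3_def by (simp add: field_simps)
    finally show ?thesis .
  qed

  have q_bigo: "q c p \<in> O[at_top](\<lambda>x. complex_of_real (x powr r))" if "p \<le> r" for c p r
    unfolding q_def using bigo_powr_mono[OF that] .
  have err: "(\<lambda>x. \<kappa> * D x) \<in> O[at_top](\<lambda>x. complex_of_real (x powr r))" if "e \<le> r" for r
  proof (rule landau_o.bigI[of "norm \<kappa> * (\<bar>K1\<bar> + \<bar>K2\<bar>) + 1"])
    show "eventually (\<lambda>x. norm (\<kappa> * D x) \<le> (norm \<kappa> * (\<bar>K1\<bar> + \<bar>K2\<bar>) + 1) * norm (complex_of_real (x powr r))) at_top"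
      using eventually_ge_at_top[of 1]
    proof eventually_elim
      case (elim x)
      have "norm (D x) \<le> K1 * x powr (\<rho> / 2 + (2 * k - 1) / 4) + K2 * x powr (\<rho> / 2 + 1 / 4)"
        using elim by (intro D_bound) auto
      also have "\<dots> \<le> \<bar>K1\<bar> * x powr r + \<bar>K2\<bar> * x powr r"
        using elim that by (intro add_mono mult_mono powr_mono) (auto simp: e_def)
      finally have "norm \<kappa> * norm (D x) \<le> norm \<kappa> * (\<bar>K1\<bar> * x powr r + \<bar>K2\<bar> * x powr r)"
        by (intro mult_left_mono) auto
      also have "\<dots> \<le> (norm \<kappa> * (\<bar>K1\<bar> + \<bar>K2\<bar>) + 1) * x powr r"
        by (simp add: algebra_simps)
      finally show ?case by (simp add: norm_mult)
    qed
  qed (intro add_nonneg_pos mult_nonneg_nonneg, auto)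
  \<comment> \<open>All four estimates have this shape: \<open>m\<close> is the part of Q_\<rho>
    that is kept, \<open>h\<close> the part that is discarded, and the Bessel series fits as soon as
    its exponent \<open>e\<close> is at most r.\<close>
  have combine: "(\<lambda>x. riesz_sum k \<rho> ap am x - m x) \<in> O[at_top](\<lambda>x. complex_of_real (x powr r))"
    if "\<And>x. x > 0 \<Longrightarrow> Q x - m x = h x" "h \<in> O[at_top](\<lambda>x. complex_of_real (x powr r))" "e \<le> r" for m h r
  proof -
    have "(\<lambda>x. h x + \<kappa> * D x) \<in> O[at_top](\<lambda>x. complex_of_real (x powr r))"
      by (intro sum_in_bigo that err)
    moreover have "eventually (\<lambda>x. h x + \<kappa> * D x = riesz_sum k \<rho> ap am x - m x) at_top"
      using eventually_gt_at_top[of 0] by eventually_elim (simp add: S_eq that(1)[symmetric])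
    ultimately show ?thesis by (rule landau_o.big.in_cong[THEN iffD1, rotated])
  qed

  have main: "(\<lambda>x. riesz_sum k \<rho> ap am x - Q x) \<in> O[at_top](\<lambda>x. complex_of_real (x powr e))"
    by (rule combine[where h = "\<lambda>_. 0"]) auto
  have gt1: "(\<lambda>x. riesz_sum k \<rho> ap am x - q c3 (\<rho> + k) x) \<in> O[at_top](\<lambda>x. complex_of_real (x powr (\<rho> + 1)))"
    if "1 < k" "k \<le> 2"
  proof (rule combine)
    \<comment> \<open>Here \<open>k \<le> 2\<close> brings the exponent \<rho> + k - 1 down to at
      most \<rho> + 1.\<close>
    show "(\<lambda>x. q c0 \<rho> x + q c1 (\<rho> + 1) x + q c2 (\<rho> + k - 1) x) \<in> O[at_top](\<lambda>x. complex_of_real (x powr (\<rho> + 1)))"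
      using that by (intro sum_in_bigo q_bigo) auto
    show "e \<le> \<rho> + 1" using that cond by (auto simp: e_def max_def field_simps)
  qed (simp add: Q_eq)
  \<comment> \<open>At k = 1 the exponents \<rho> + 1 and \<rho> + k coincide, so the terms of
    b^-(0) and b^+(0) merge; likewise \<rho> + k - 1 is \<rho>.\<close>
  have eq1: "(\<lambda>x. riesz_sum k \<rho> ap am x - q (c1 + c3) (\<rho> + 1) x) \<in> O[at_top](\<lambda>x. complex_of_real (x powr \<rho>))"
    if "k = 1"
  proof (rule combine)
    show "(\<lambda>x. q c0 \<rho> x + q c2 \<rho> x) \<in> O[at_top](\<lambda>x. complex_of_real (x powr \<rho>))"
      using that by (intro sum_in_bigo q_bigo) auto
    \<comment> \<open>Here \<open>e\<close> is \<rho>/2 + 1/4, and \<rho> > 1/2 is what makes it at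
      most \<rho>.\<close>
    show "e \<le> \<rho>" using that cond by (auto simp: e_def)
  qed (use that in \<open>simp add: Q_eq q_def ring_distribs\<close>)
  have lt1: "(\<lambda>x. riesz_sum k \<rho> ap am x - q c1 (\<rho> + 1) x) \<in> O[at_top](\<lambda>x. complex_of_real (x powr (max \<rho> (\<rho> + k))))"
    if "k < 1"
  proof (rule combine)
    show "(\<lambda>x. q c0 \<rho> x + q c2 (\<rho> + k - 1) x + q c3 (\<rho> + k) x) \<in> O[at_top](\<lambda>x. complex_of_real (x powr (max \<rho> (\<rho> + k))))"
      using that by (intro sum_in_bigo q_bigo) auto
    show "e \<le> max \<rho> (\<rho> + k)" using that cond by (auto simp: e_def)
  qed (simp add: Q_eq)
  have c13: "c1 + c3 = 2 * complex_of_real pi * \<i> / complex_of_real (sqrt (real N) * Gamma (\<rho> + 2)) * (bm 0 + bp 0)"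
    if "k = 1"
  proof -
    have "real N powr (k / 2 - 1) = 1 / sqrt (real N)"
      using that \<open>N > 0\<close> by (simp add: powr_minus_divide powr_half_sqrt)
    moreover have "real N powr (k / 2) = sqrt (real N)" using that by (simp add: powr_half_sqrt)
    moreover have "\<rho> + k + 1 = \<rho> + 2" "I = \<i>" using that by (simp_all add: I_def)
    ultimately show ?thesis
      unfolding c1_def c3_def using that by (simp add: add_divide_distrib ring_distribs mult_ac add.commute)
  qed
  show ?thesis
  proof (intro conjI impI)
    assume "1 < k \<and> k \<le> 2"
    thus "(\<lambda>x. riesz_sum k \<rho> ap am x
               - bp 0 * \<i> powr complex_of_real k * complex_of_real ((2 * pi) powr k)
                   / complex_of_real (real N powr (k / 2) * Gamma (\<rho> + k + 1))
                   * complex_of_real (x powr (\<rho> + k)))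
           \<in> O[at_top](\<lambda>x. complex_of_real (x powr (\<rho> + 1)))"
      using gt1 by (simp only: q_def c3_def I_def)
  next
    assume "k = 1"
    thus "(\<lambda>x. riesz_sum k \<rho> ap am x
               - 2 * complex_of_real pi * \<i> / complex_of_real (sqrt (real N) * Gamma (\<rho> + 2))
                   * (bm 0 + bp 0) * complex_of_real (x powr (\<rho> + 1)))
           \<in> O[at_top](\<lambda>x. complex_of_real (x powr \<rho>))"
      using eq1 by (simp only: q_def c13)
  next
    assume "k < 1"
    thus "(\<lambda>x. riesz_sum k \<rho> ap am x
               - complex_of_real (2 * pi * real N powr (k / 2 - 1)) * bm 0 * \<i> powr complex_of_real k
                   / complex_of_real (Gamma (\<rho> + 2))
                   * complex_of_real (x powr (\<rho> + 1)))
           \<in> O[at_top](\<lambda>x. complex_of_real (x powr max \<rho> (\<rho> + k)))"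
      using lt1 by (simp only: q_def c1_def I_def)
  qed (use main in \<open>simp only: Q_def e_def\<close>)
qed

end
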